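(* Let $\mathcal A$ be a Banach algebra with product $\pi:\mathcal A\times\mathcal A\to\mathcal A$, and let $\pi^*:\mathcal A^*\times\mathcal A\to\mathcal A^*$ be defined by $\langle\pi^*(a^*,a),b\rangle=\langle a^*,\pi(a,b)\rangle$ for $a^*\in\mathcal A^*$, $a,b\in\mathcal A$. Suppose that every derivation $D:\mathcal A\to\mathcal A^*$ satisfies $D^{**}(\mathcal A^{**})\subseteq Z_\ell(\pi^* )$, where $Z_\ell(\pi^* )\subseteq\mathcal A^{***}$ is the left topological centre of $\pi^*$. If $(\mathcal A^{**},\Box)$, with the first Arens product, is weakly amenable, then $\mathcal A$ is weakly amenable.
   Context: For a bounded bilinear map $f:\mathcal X\times\mathcal Y\to\mathcal Z$ of normed spaces, the adjoint $f^*:\mathcal Z^*\times\mathcal X\to\mathcal Y^*$ is $\langle f^*(z^*,x),y\rangle=\langle z^*,f(x,y)\rangle$; further $f^{**}=(f^* )^*$ and $f^{***}=(f^{**})^*:\mathcal X^{**}\times\mathcal Y^{**}\to\mathcal Z^{**}$. The left topological centre of $f$ is $Z_\ell(f)=\{x^{**}\in\mathcal X^{**}: y^{**}\mapsto f^{***}(x^{**},y^{**}),\ \mathcal Y^{**}\to\mathcal Z^{**},\ \text{is } w^*\text{-}w^*\text{-continuous}\}$. With $\pi$ the product of $\mathcal A$, the first Arens product on $\mathcal A^{**}$ is $a^{**}\Box b^{**}=\pi^{***}(a^{**},b^{**})$. For a Banach algebra $\mathcal B$, the dual $\mathcal B^*$ is a Banach $\mathcal B$-bimodule via $\langle b\cdot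 f,c\rangle=\langle f,cb\rangle$ and $\langle f\cdot b,c\rangle=\langle f,bc\rangle$. A derivation $D:\mathcal B\to\mathcal B^*$ is a bounded linear map with $D(ab)=D(a)\cdot b+a\cdot D(b)$; it is inner if $D(a)=a\cdot f-f\cdot a$ for some fixed $f\in\mathcal B^*$ and all $a\in\mathcal B$. $\mathcal B$ is weakly amenable if every (bounded) derivation $\mathcal B\to\mathcal B^*$ is inner. $D^{**}:\mathcal A^{**}\to\mathcal A^{***}$ is the second adjoint of the linear map $D:\mathcal A\to\mathcal A^*$. *)

theory Defs
  imports "HOL-Analysis.Analysis" "HOL-Algebra.Module"
begin

text \<open>
  The type classes for normed spaces only provide real scalars, so normed spaces over a scalar
  field \<open>'k\<close> are modules with an explicit carrier. The sort \<open>{real_normed_field, banach}\<close> leaves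
  exactly the scalar fields \<open>\<real>\<close> and \<open>\<complex>\<close> (Gelfand-Mazur); both are instances.
  The record inherits \<open>mult\<close> and \<open>one\<close> from rings: \<open>mult\<close> is the product of an algebra and is
  irrelevant for a mere normed space; \<open>one\<close> is never used, and algebras need not be unital.
\<close>

record ('k, 'a) normed_module = "('k, 'a) module" +
  nrm :: "'a \<Rightarrow> real"

definition scalar_field :: "('k::{real_normed_field,banach}, 'k) normed_module" where
  "scalar_field = \<lparr>carrier = UNIV, mult = (*), one = 1, zero = 0, add = (+), smult = (*), nrm = norm\<rparr>"

locale normed_space = module scalar_field X
  for X :: "('k::{real_normed_field,banach}, 'a) normed_module" (structure) +
  assumes nrm_nonneg: "x \<in> carrier X \<Longrightarrow> 0 \<le> nrm X x"
    and nrm_eq_0_iff: "x \<in> carrier X \<Longrightarrow> nrm X x = 0 \<longleftrightarrow> x = \<zero>\<^bsub>X\<^esub>"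
    and nrm_smult: "x \<in> carrier X \<Longrightarrow> nrm X (c \<odot>\<^bsub>X\<^esub> x) = norm c * nrm X x"
    and nrm_triangle:
      "\<lbrakk>x \<in> carrier X; y \<in> carrier X\<rbrakk> \<Longrightarrow> nrm X (x \<oplus>\<^bsub>X\<^esub> y) \<le> nrm X x + nrm X y"

text \<open>The value \<open>0\<close> off the carrier is a dummy: \<open>Metric_space\<close> asks for symmetry everywhere.\<close>

definition nrm_dist :: "('k::{real_normed_field,banach}, 'a) normed_module \<Rightarrow> 'a \<Rightarrow> 'a \<Rightarrow> real" where
  "nrm_dist X x y = (if x \<in> carrier X \<and> y \<in> carrier X then nrm X (x \<ominus>\<^bsub>X\<^esub> y) else 0)"

locale banach_space = normed_space +
  assumes complete: "Metric_space.mcomplete (carrier X) (nrm_dist X)"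

locale banach_algebra = banach_space A
  for A :: "('k::{real_normed_field,banach}, 'a) normed_module" (structure) +
  assumes mult_closed: "\<lbrakk>x \<in> carrier A; y \<in> carrier A\<rbrakk> \<Longrightarrow> x \<otimes>\<^bsub>A\<^esub> y \<in> carrier A"
    and mult_assoc: "\<lbrakk>x \<in> carrier A; y \<in> carrier A; z \<in> carrier A\<rbrakk> \<Longrightarrow>
      (x \<otimes>\<^bsub>A\<^esub> y) \<otimes>\<^bsub>A\<^esub> z = x \<otimes>\<^bsub>A\<^esub> (y \<otimes>\<^bsub>A\<^esub> z)"
    and mult_add_left: "\<lbrakk>x \<in> carrier A; y \<in> carrier A; z \<in> carrier A\<rbrakk> \<Longrightarrow>
      (x \<oplus>\<^bsub>A\<^esub> y) \<otimes>\<^bsub>A\<^esub> z = x \<otimes>\<^bsub>A\<^esub> z \<oplus>\<^bsub>A\<^esub> y \<otimes>\<^bsub>A\<^esub> z"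
    and mult_add_right: "\<lbrakk>x \<in> carrier A; y \<in> carrier A; z \<in> carrier A\<rbrakk> \<Longrightarrow>
      x \<otimes>\<^bsub>A\<^esub> (y \<oplus>\<^bsub>A\<^esub> z) = x \<otimes>\<^bsub>A\<^esub> y \<oplus>\<^bsub>A\<^esub> x \<otimes>\<^bsub>A\<^esub> z"
    and mult_smult_left: "\<lbrakk>x \<in> carrier A; y \<in> carrier A\<rbrakk> \<Longrightarrow>
      (c \<odot>\<^bsub>A\<^esub> x) \<otimes>\<^bsub>A\<^esub> y = c \<odot>\<^bsub>A\<^esub> (x \<otimes>\<^bsub>A\<^esub> y)"
    and mult_smult_right: "\<lbrakk>x \<in> carrier A; y \<in> carrier A\<rbrakk> \<Longrightarrow>
      x \<otimes>\<^bsub>A\<^esub> (c \<odot>\<^bsub>A\<^esub> y) = c \<odot>\<^bsub>A\<^esub> (x \<otimes>\<^bsub>A\<^esub> y)"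
    and nrm_mult: "\<lbrakk>x \<in> carrier A; y \<in> carrier A\<rbrakk> \<Longrightarrow> nrm A (x \<otimes>\<^bsub>A\<^esub> y) \<le> nrm A x * nrm A y"

definition bounded_linear_map ::
  "('k::{real_normed_field,banach}, 'a) normed_module \<Rightarrow> ('k, 'b) normed_module \<Rightarrow> ('a \<Rightarrow> 'b) \<Rightarrow> bool"
where
  "bounded_linear_map X Y T \<longleftrightarrow>
     T \<in> carrier X \<rightarrow> carrier Y \<and>
     (\<forall>x\<in>carrier X. \<forall>y\<in>carrier X. T (x \<oplus>\<^bsub>X\<^esub> y) = T x \<oplus>\<^bsub>Y\<^esub> T y) \<and>
     (\<forall>c. \<forall>x\<in>carrier X. T (c \<odot>\<^bsub>X\<^esub> x) = c \<odot>\<^bsub>Y\<^esub> T x) \<and>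
     (\<exists>C. \<forall>x\<in>carrier X. nrm Y (T x) \<le> C * nrm X x)"

text \<open>
  The elements of the dual are the bounded linear functionals, made \<open>undefined\<close> off the carrier
  so that equality of functionals is equality of functions. No product is put on the dual.
\<close>

definition dual :: "('k::{real_normed_field,banach}, 'a) normed_module \<Rightarrow> ('k, 'a \<Rightarrow> 'k) normed_module"
where
  "dual X =
    \<lparr>carrier = {f \<in> extensional (carrier X). bounded_linear_map X scalar_field f},
     mult = undefined, one = undefined,
     zero = (\<lambda>x\<in>carrier X. 0),
     add = (\<lambda>f g. \<lambda>x\<in>carrier X. f x + g x),
     smult = (\<lambda>c f. \<lambda>x\<in>carrier X. c * f x),
     nrm = (\<lambda>f. SUP x\<in>{x \<in> carrier X. nrm X x \<le> 1}. norm (f x))\<rparr>"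

abbreviation bidual ::
  "('k::{real_normed_field,banach}, 'a) normed_module \<Rightarrow> ('k, ('a \<Rightarrow> 'k) \<Rightarrow> 'k) normed_module"
where
  "bidual X \<equiv> dual (dual X)"

text \<open>The weak* topology on the dual of \<open>X\<close> is the topology of pointwise convergence on \<open>X\<close>.\<close>

definition weak_star :: "('k::{real_normed_field,banach}, 'a) normed_module \<Rightarrow> ('a \<Rightarrow> 'k) topology" where
  "weak_star X = subtopology (product_topology (\<lambda>_. euclidean) (carrier X)) (carrier (dual X))"

text \<open>
  For a bounded bilinear \<open>f : X \<times> Y \<rightarrow> Z\<close>, its adjoint \<open>f* : Z* \<times> X \<rightarrow> Y*\<close> is \<open>bilinear_adjoint Y f\<close>;
  hence \<open>f** : Y** \<times> Z* \<rightarrow> X*\<close> is \<open>bilinear_adjoint X (bilinear_adjoint Y f)\<close>.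
\<close>

definition bilinear_adjoint ::
  "('k::{real_normed_field,banach}, 'b) normed_module \<Rightarrow> ('a \<Rightarrow> 'b \<Rightarrow> 'c) \<Rightarrow> ('c \<Rightarrow> 'k) \<Rightarrow> 'a \<Rightarrow> ('b \<Rightarrow> 'k)"
where
  "bilinear_adjoint Y f z' x = (\<lambda>y\<in>carrier Y. z' (f x y))"

definition bilinear_triadjoint ::
  "('k::{real_normed_field,banach}, 'a) normed_module \<Rightarrow> ('k, 'b) normed_module \<Rightarrow> ('k, 'c) normed_module \<Rightarrow>
   ('a \<Rightarrow> 'b \<Rightarrow> 'c) \<Rightarrow> (('a \<Rightarrow> 'k) \<Rightarrow> 'k) \<Rightarrow> (('b \<Rightarrow> 'k) \<Rightarrow> 'k) \<Rightarrow> (('c \<Rightarrow> 'k) \<Rightarrow> 'k)"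
where
  "bilinear_triadjoint X Y Z f =
     bilinear_adjoint (dual Z) (bilinear_adjoint X (bilinear_adjoint Y f))"

definition left_topological_centre ::
  "('k::{real_normed_field,banach}, 'a) normed_module \<Rightarrow> ('k, 'b) normed_module \<Rightarrow> ('k, 'c) normed_module \<Rightarrow>
   ('a \<Rightarrow> 'b \<Rightarrow> 'c) \<Rightarrow> (('a \<Rightarrow> 'k) \<Rightarrow> 'k) set"
where
  "left_topological_centre X Y Z f =
     {x'' \<in> carrier (bidual X).
        continuous_map (weak_star (dual Y)) (weak_star (dual Z)) (bilinear_triadjoint X Y Z f x'')}"

definition arens :: "('k::{real_normed_field,banach}, 'a) normed_module \<Rightarrow> ('k, ('a \<Rightarrow> 'k) \<Rightarrow> 'k) normed_module"
where
  "arens A = (bidual A)\<lparr>mult := bilinear_triadjoint A A A (mult A)\<rparr>"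

text \<open>For \<open>T : X \<rightarrow> Y\<close>, \<open>linear_adjoint X T\<close> is \<open>T* : Y* \<rightarrow> X*\<close>.\<close>

definition linear_adjoint ::
  "('k::{real_normed_field,banach}, 'a) normed_module \<Rightarrow> ('a \<Rightarrow> 'b) \<Rightarrow> ('b \<Rightarrow> 'k) \<Rightarrow> ('a \<Rightarrow> 'k)"
where
  "linear_adjoint X T y' = (\<lambda>x\<in>carrier X. y' (T x))"

definition linear_biadjoint ::
  "('k::{real_normed_field,banach}, 'a) normed_module \<Rightarrow> ('k, 'b) normed_module \<Rightarrow> ('a \<Rightarrow> 'b) \<Rightarrow>
   (('a \<Rightarrow> 'k) \<Rightarrow> 'k) \<Rightarrow> (('b \<Rightarrow> 'k) \<Rightarrow> 'k)"
where
  "linear_biadjoint X Y T = linear_adjoint (dual Y) (linear_adjoint X T)"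

definition dual_left_act ::
  "('k::{real_normed_field,banach}, 'a) normed_module \<Rightarrow> 'a \<Rightarrow> ('a \<Rightarrow> 'k) \<Rightarrow> ('a \<Rightarrow> 'k)"
where
  "dual_left_act B b f = (\<lambda>c\<in>carrier B. f (c \<otimes>\<^bsub>B\<^esub> b))"

definition dual_right_act ::
  "('k::{real_normed_field,banach}, 'a) normed_module \<Rightarrow> ('a \<Rightarrow> 'k) \<Rightarrow> 'a \<Rightarrow> ('a \<Rightarrow> 'k)"
where
  "dual_right_act B f b = (\<lambda>c\<in>carrier B. f (b \<otimes>\<^bsub>B\<^esub> c))"

definition derivation ::
  "('k::{real_normed_field,banach}, 'a) normed_module \<Rightarrow> ('a \<Rightarrow> 'a \<Rightarrow> 'k) \<Rightarrow> bool"
where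
  "derivation B D \<longleftrightarrow>
     bounded_linear_map B (dual B) D \<and>
     (\<forall>a\<in>carrier B. \<forall>b\<in>carrier B.
        D (a \<otimes>\<^bsub>B\<^esub> b) = dual_right_act B (D a) b \<oplus>\<^bsub>dual B\<^esub> dual_left_act B a (D b))"

definition inner_derivation ::
  "('k::{real_normed_field,banach}, 'a) normed_module \<Rightarrow> ('a \<Rightarrow> 'a \<Rightarrow> 'k) \<Rightarrow> bool"
where
  "inner_derivation B D \<longleftrightarrow>
     (\<exists>f\<in>carrier (dual B). \<forall>a\<in>carrier B.
        D a = dual_left_act B a f \<ominus>\<^bsub>dual B\<^esub> dual_right_act B f a)"

definition weakly_amenable :: "('k::{real_normed_field,banach}, 'a) normed_module \<Rightarrow> bool" where
  "weakly_amenable B \<longleftrightarrow> (\<forall>D. derivation B D \<longrightarrow> inner_derivation B D)"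

lemma Metric_space_nrm_dist:
  fixes X :: "('k::{real_normed_field,banach}, 'a) normed_module"
  assumes "normed_space X" shows "Metric_space (carrier X) (nrm_dist X)"
proof -
  interpret normed_space X by fact
  have neg: "nrm X (\<ominus>\<^bsub>X\<^esub> z) = nrm X z" if "z \<in> carrier X" for z
  proof -
    have "(\<ominus>\<^bsub>scalar_field\<^esub> \<one>\<^bsub>scalar_field\<^esub>) \<odot>\<^bsub>X\<^esub> z = \<ominus>\<^bsub>X\<^esub> z"
      using smult_l_minus[of "\<one>\<^bsub>scalar_field\<^esub>" z] that by simp
    moreover have "norm (\<ominus>\<^bsub>scalar_field\<^esub> (\<one>\<^bsub>scalar_field\<^esub>) :: 'k) = 1"
    proof -
      have "\<ominus>\<^bsub>scalar_field\<^esub> (\<one>\<^bsub>scalar_field\<^esub>) = (-1::'k)"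
        by (rule R.minus_equality) (simp_all add: scalar_field_def)
      then show ?thesis by simp
    qed
    ultimately show ?thesis using nrm_smult[OF that] by (metis mult_1)
  qed
  have com: "nrm X (x \<ominus>\<^bsub>X\<^esub> y) = nrm X (y \<ominus>\<^bsub>X\<^esub> x)" if "x \<in> carrier X" "y \<in> carrier X" for x y
  proof -
    have "\<ominus>\<^bsub>X\<^esub> (x \<ominus>\<^bsub>X\<^esub> y) = y \<ominus>\<^bsub>X\<^esub> x"
      using that by (simp add: a_minus_def minus_add a_comm)
    then show ?thesis using neg[of "x \<ominus>\<^bsub>X\<^esub> y"] that by simp
  qed
  have tri: "nrm X (x \<ominus>\<^bsub>X\<^esub> z) \<le> nrm X (x \<ominus>\<^bsub>X\<^esub> y) + nrm X (y \<ominus>\<^bsub>X\<^esub> z)"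
    if "x \<in> carrier X" "y \<in> carrier X" "z \<in> carrier X" for x y z
  proof -
    have "(x \<ominus>\<^bsub>X\<^esub> y) \<oplus>\<^bsub>X\<^esub> (y \<ominus>\<^bsub>X\<^esub> z) = x \<ominus>\<^bsub>X\<^esub> z"
      using that by (simp add: a_minus_def a_assoc r_neg1)
    then show ?thesis using nrm_triangle[of "x \<ominus>\<^bsub>X\<^esub> y" "y \<ominus>\<^bsub>X\<^esub> z"] that by simp
  qed
  have mz: "x \<ominus>\<^bsub>X\<^esub> y = \<zero>\<^bsub>X\<^esub> \<longleftrightarrow> x = y" if "x \<in> carrier X" "y \<in> carrier X" for x y
    using that minus_equality[of x "\<ominus>\<^bsub>X\<^esub> y"] minus_minus[of y] by (auto simp: a_minus_def r_neg)
  show ?thesis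
    by unfold_locales (auto simp: nrm_dist_def nrm_nonneg com nrm_eq_0_iff tri mz)
qed

lemma scalar_field_simps [simp]: "carrier scalar_field = UNIV" "x \<oplus>\<^bsub>scalar_field\<^esub> y = x + y" "x \<otimes>\<^bsub>scalar_field\<^esub> y = x * y"
  "\<one>\<^bsub>scalar_field\<^esub> = 1" "\<zero>\<^bsub>scalar_field\<^esub> = 0" "x \<odot>\<^bsub>scalar_field\<^esub> y = x * y" "nrm scalar_field x = norm x"
  by (auto simp: scalar_field_def)

lemma cring_scalar_field: "cring (scalar_field :: ('k::{real_normed_field,banach}, 'k) normed_module)"
proof (rule cringI)
  show "abelian_group (scalar_field :: ('k, 'k) normed_module)"
    by (rule abelian_groupI) (auto simp: algebra_simps intro: exI[of _ "- _"] right_minus left_minus)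
qed (unfold_locales, auto simp: algebra_simps)

lemma normed_space_dual:
  fixes X :: "('k::{real_normed_field,banach}, 'a) normed_module"
  assumes "normed_space X" shows "normed_space (dual X)"
proof -
  interpret normed_space X by fact
  have D: "f \<in> carrier (dual X) \<longleftrightarrow> f \<in> extensional (carrier X) \<and>
     (\<forall>x\<in>carrier X. \<forall>y\<in>carrier X. f (x \<oplus>\<^bsub>X\<^esub> y) = f x + f y) \<and>
     (\<forall>c. \<forall>x\<in>carrier X. f (c \<odot>\<^bsub>X\<^esub> x) = c * f x) \<and>
     (\<exists>C. \<forall>x\<in>carrier X. norm (f x) \<le> C * nrm X x)" for f
    by (simp add: dual_def bounded_linear_map_def)
  have sm: "c \<odot>\<^bsub>X\<^esub> x \<in> carrier X" if "x \<in> carrier X" for c x using that smult_closed[of c x] by simp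
  have add: "f \<oplus>\<^bsub>dual X\<^esub> g = (\<lambda>x\<in>carrier X. f x + g x)" for f g by (simp add: dual_def)
  have smu: "c \<odot>\<^bsub>dual X\<^esub> g = (\<lambda>x\<in>carrier X. c * g x)" for c g by (simp add: dual_def)
  have zer: "\<zero>\<^bsub>dual X\<^esub> = (\<lambda>x\<in>carrier X. 0)" by (simp add: dual_def)
  have Dadd: "f (x \<oplus>\<^bsub>X\<^esub> y) = f x + f y" if "f \<in> carrier (dual X)" "x \<in> carrier X" "y \<in> carrier X" for f x y
    using that D[of f] by blast
  have Dsm: "f (c \<odot>\<^bsub>X\<^esub> x) = c * f x" if "f \<in> carrier (dual X)" "x \<in> carrier X" for f c x
    using that D[of f] by blast
  have Dbd: "\<exists>C. \<forall>x\<in>carrier X. norm (f x) \<le> C * nrm X x" if "f \<in> carrier (dual X)" for f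
    using that D[of f] by blast
  have DI: "(\<lambda>x\<in>carrier X. h x) \<in> carrier (dual X)"
    if "\<And>x y. \<lbrakk>x \<in> carrier X; y \<in> carrier X\<rbrakk> \<Longrightarrow> h (x \<oplus>\<^bsub>X\<^esub> y) = h x + h y"
      and "\<And>c x. x \<in> carrier X \<Longrightarrow> h (c \<odot>\<^bsub>X\<^esub> x) = c * h x"
      and "\<And>x. x \<in> carrier X \<Longrightarrow> norm (h x) \<le> C * nrm X x" for h C
    unfolding D by (intro conjI exI[of _ C]) (simp_all add: that sm)
  have addc: "(\<lambda>x\<in>carrier X. f x + g x) \<in> carrier (dual X)" if f: "f \<in> carrier (dual X)" and g: "g \<in> carrier (dual X)" for f g
  proof -
    obtain C1 where C1: "\<forall>x\<in>carrier X. norm (f x) \<le> C1 * nrm X x" using Dbd[OF f] ..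
    obtain C2 where C2: "\<forall>x\<in>carrier X. norm (g x) \<le> C2 * nrm X x" using Dbd[OF g] ..
    show ?thesis
    proof (rule DI[where C = "C1 + C2"])
      fix x assume "x \<in> carrier X"
      then have "norm (f x) \<le> C1 * nrm X x" "norm (g x) \<le> C2 * nrm X x"
        using C1 C2 by blast+
      then show "norm (f x + g x) \<le> (C1 + C2) * nrm X x"
        unfolding distrib_right by (intro norm_triangle_le add_mono)
    qed (simp_all add: Dadd[OF f] Dadd[OF g] Dsm[OF f] Dsm[OF g] distrib_left)
  qed
  have smc: "(\<lambda>x\<in>carrier X. c * f x) \<in> carrier (dual X)" if f: "f \<in> carrier (dual X)" for f c
  proof -
    obtain C1 where C1: "\<forall>x\<in>carrier X. norm (f x) \<le> C1 * nrm X x" using Dbd[OF f] ..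
    show ?thesis
    proof (rule DI[where C = "norm c * C1"])
      fix x assume "x \<in> carrier X"
      then show "norm (c * f x) \<le> norm c * C1 * nrm X x"
        using C1 by (simp add: norm_mult mult.assoc mult_left_mono)
    qed (simp_all add: Dadd[OF f] Dsm[OF f] distrib_left mult.left_commute)
  qed
  have zc: "(\<lambda>x\<in>carrier X. 0) \<in> carrier (dual X)" by (rule DI[where C = 0]) simp_all
  have e: "f = (\<lambda>x\<in>carrier X. f x)" if "f \<in> carrier (dual X)" for f
    using that D[of f] extensional_restrict[of f] by simp
  have ab: "abelian_group (dual X)"
  proof (rule abelian_groupI)
    fix f g assume f: "f \<in> carrier (dual X)" and g: "g \<in> carrier (dual X)"
    show "f \<oplus>\<^bsub>dual X\<^esub> g \<in> carrier (dual X)" unfolding add by (rule addc[OF f g])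
    show "f \<oplus>\<^bsub>dual X\<^esub> g = g \<oplus>\<^bsub>dual X\<^esub> f" unfolding add by (simp only: add.commute)
  next
    show "\<zero>\<^bsub>dual X\<^esub> \<in> carrier (dual X)" unfolding zer by (rule zc)
  next
    fix f g h assume "f \<in> carrier (dual X)" "g \<in> carrier (dual X)" "h \<in> carrier (dual X)"
    show "f \<oplus>\<^bsub>dual X\<^esub> g \<oplus>\<^bsub>dual X\<^esub> h = f \<oplus>\<^bsub>dual X\<^esub> (g \<oplus>\<^bsub>dual X\<^esub> h)"
      unfolding add by (rule restrict_ext) (simp add: add.assoc)
  next
    fix f assume f: "f \<in> carrier (dual X)"
    have "(\<lambda>x\<in>carrier X. 0 + f x) = f" using e[OF f] by simp
    then show "\<zero>\<^bsub>dual X\<^esub> \<oplus>\<^bsub>dual X\<^esub> f = f"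
      unfolding add zer by (metis (mono_tags, lifting) restrict_apply' restrict_ext)
    have "(\<lambda>x\<in>carrier X. -1 * f x) \<oplus>\<^bsub>dual X\<^esub> f = \<zero>\<^bsub>dual X\<^esub>"
      unfolding add zer by (rule restrict_ext) simp
    then show "\<exists>g\<in>carrier (dual X). g \<oplus>\<^bsub>dual X\<^esub> f = \<zero>\<^bsub>dual X\<^esub>"
      using smc[OF f] by blast
  qed
  have m: "module scalar_field (dual X)"
  proof (rule moduleI[OF cring_scalar_field ab])
    fix c :: 'k and f assume f: "f \<in> carrier (dual X)"
    show "c \<odot>\<^bsub>dual X\<^esub> f \<in> carrier (dual X)" unfolding smu by (rule smc[OF f])
    show "\<one>\<^bsub>scalar_field\<^esub> \<odot>\<^bsub>dual X\<^esub> f = f" unfolding smu using e[OF f] by simp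
    fix d :: 'k
    show "(c \<oplus>\<^bsub>scalar_field\<^esub> d) \<odot>\<^bsub>dual X\<^esub> f = c \<odot>\<^bsub>dual X\<^esub> f \<oplus>\<^bsub>dual X\<^esub> d \<odot>\<^bsub>dual X\<^esub> f"
      unfolding smu add by (rule restrict_ext) (simp add: distrib_right)
    show "(c \<otimes>\<^bsub>scalar_field\<^esub> d) \<odot>\<^bsub>dual X\<^esub> f = c \<odot>\<^bsub>dual X\<^esub> (d \<odot>\<^bsub>dual X\<^esub> f)"
      unfolding smu by (rule restrict_ext) (simp add: mult.assoc)
    fix g
    show "c \<odot>\<^bsub>dual X\<^esub> (f \<oplus>\<^bsub>dual X\<^esub> g) = c \<odot>\<^bsub>dual X\<^esub> f \<oplus>\<^bsub>dual X\<^esub> c \<odot>\<^bsub>dual X\<^esub> g"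
      unfolding smu add by (rule restrict_ext) (simp add: distrib_left)
  qed
  define S where "S = {x \<in> carrier X. nrm X x \<le> 1}"
  have nr: "nrm (dual X) f = (SUP x\<in>S. norm (f x))" for f by (simp add: dual_def S_def)
  have z0: "\<zero>\<^bsub>X\<^esub> \<in> S" using nrm_eq_0_iff[of "\<zero>\<^bsub>X\<^esub>"] by (auto simp: S_def)
  have bdd: "bdd_above ((\<lambda>x. norm (f x)) ` S)" if fd: "f \<in> carrier (dual X)" for f
  proof -
    obtain C where C: "\<forall>x\<in>carrier X. norm (f x) \<le> C * nrm X x" using Dbd[OF fd] ..
    have "norm (f x) \<le> \<bar>C\<bar>" if "x \<in> S" for x
    proof -
      have "C * nrm X x \<le> \<bar>C\<bar> * 1" using that nrm_nonneg[of x] by (intro mult_mono) (auto simp: S_def)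
      moreover have "norm (f x) \<le> C * nrm X x" using C that by (simp add: S_def)
      ultimately show ?thesis by simp
    qed
    then show ?thesis by (auto intro!: bdd_aboveI2)
  qed
  have le: "norm (f x) \<le> nrm (dual X) f" if "f \<in> carrier (dual X)" "x \<in> S" for f x
    unfolding nr by (rule cSUP_upper[OF that(2) bdd[OF that(1)]])
  show ?thesis
  proof (intro normed_space.intro m normed_space_axioms.intro)
    fix f assume f: "f \<in> carrier (dual X)"
    show n0: "0 \<le> nrm (dual X) f" using le[OF f z0] norm_ge_zero order_trans by blast
    have SX: "x \<in> S \<Longrightarrow> x \<in> carrier X" for x by (simp add: S_def)
    show "nrm (dual X) f = 0 \<longleftrightarrow> f = \<zero>\<^bsub>dual X\<^esub>"
    proof
      assume 0: "nrm (dual X) f = 0"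
      have "f x = 0" if x: "x \<in> carrier X" for x
      proof (cases "nrm X x = 0")
        case True
        obtain C where "\<forall>x\<in>carrier X. norm (f x) \<le> C * nrm X x" using Dbd[OF f] ..
        with x have "norm (f x) \<le> C * nrm X x" by blast
        then show ?thesis using True by simp
      next
        case False
        then have p: "nrm X x > 0" using nrm_nonneg[OF x] by simp
        let ?c = "of_real (1 / nrm X x) :: 'k"
        have "?c \<odot>\<^bsub>X\<^esub> x \<in> S" using nrm_smult[OF x, of ?c] p sm[OF x] by (auto simp: S_def norm_divide)
        from le[OF f this] 0 have "?c * f x = 0" using Dsm[OF f x, of ?c] by simp
        then show ?thesis using p by auto
      qed
      then show "f = \<zero>\<^bsub>dual X\<^esub>" by (subst e[OF f]) (auto simp: zer)
    next
      assume "f = \<zero>\<^bsub>dual X\<^esub>"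
      then have "\<And>x. x \<in> S \<Longrightarrow> norm (f x) = 0" by (auto simp: zer S_def)
      then show "nrm (dual X) f = 0" using z0 n0 unfolding nr by (intro antisym cSUP_least) auto
    qed
    show "nrm (dual X) (c \<odot>\<^bsub>dual X\<^esub> f) = norm c * nrm (dual X) f" for c
    proof (cases "c = 0")
      case True
      moreover have "(SUP x\<in>S. norm ((0 \<odot>\<^bsub>dual X\<^esub> f) x)) = (SUP x\<in>S. 0)"
        by (rule SUP_cong) (simp_all add: smu SX)
      moreover have "\<dots> = (0::real)" using z0 by (intro cSUP_const) auto
      ultimately show ?thesis by (simp add: nr)
    next
      case False
      have "(SUP x\<in>S. norm c * norm (f x)) = norm c * (SUP x\<in>S. norm (f x))"
      proof (rule antisym)
        show "(SUP x\<in>S. norm c * norm (f x)) \<le> norm c * (SUP x\<in>S. norm (f x))"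
          using z0 le[OF f] by (auto intro!: cSUP_least mult_left_mono simp: nr)
        have "(SUP x\<in>S. norm (f x)) \<le> (SUP x\<in>S. norm c * norm (f x)) / norm c"
        proof (rule cSUP_least)
          fix x assume x: "x \<in> S"
          have "bdd_above ((\<lambda>x. norm c * norm (f x)) ` S)"
            using le[OF f] by (auto intro!: bdd_aboveI2[where M="norm c * nrm (dual X) f"] mult_left_mono)
          from cSUP_upper[OF x this] False show "norm (f x) \<le> (SUP x\<in>S. norm c * norm (f x)) / norm c"
            by (simp add: field_simps)
        qed (use z0 in auto)
        then show "norm c * (SUP x\<in>S. norm (f x)) \<le> (SUP x\<in>S. norm c * norm (f x))"
          using False by (simp add: field_simps)
      qed
      then show ?thesis by (simp add: nr smu SX norm_mult cong: SUP_cong)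
    qed
    fix g assume g: "g \<in> carrier (dual X)"
    show "nrm (dual X) (f \<oplus>\<^bsub>dual X\<^esub> g) \<le> nrm (dual X) f + nrm (dual X) g"
      unfolding nr[of "f \<oplus>\<^bsub>dual X\<^esub> g"] using z0
      by (intro cSUP_least) (auto simp: add SX intro!: norm_triangle_le add_mono le f g)
  qed
qed

lemma banach_algebra_of_class:
  "banach_algebra (\<lparr>carrier = (UNIV::'a::{real_normed_algebra,banach} set), mult = (*), one = undefined,
   zero = 0, add = (+), smult = scaleR, nrm = norm\<rparr>)" (is "banach_algebra ?A")
proof -
  have ab: "abelian_group ?A" by (rule abelian_groupI) (auto simp: algebra_simps intro: exI[of _ "- _"] add.left_inverse add.right_inverse right_minus)
  have m: "module scalar_field ?A" by (intro moduleI cring_scalar_field ab) (auto simp: algebra_simps)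
  have n: "normed_space ?A" by (intro normed_space.intro m normed_space_axioms.intro) (auto simp: norm_triangle_ineq)
  interpret n: normed_space ?A by fact
  have "\<ominus>\<^bsub>?A\<^esub> y = - y" for y by (rule n.minus_equality) auto
  then have d: "nrm_dist ?A = dist" by (intro ext) (simp add: nrm_dist_def a_minus_def dist_norm)
  have b: "banach_space ?A" 
    by (intro banach_space.intro n banach_space_axioms.intro) (simp add: d Met_TC.mcomplete_def Met_TC.MCauchy_def complete_UNIV)
  show ?thesis
    by (intro banach_algebra.intro b banach_algebra_axioms.intro) (auto simp: algebra_simps norm_mult_ineq)
qed

end

theory Submission
  imports Defs
begin

text \<open>
  Write \<open>T a b\<close> for \<open>\<langle>D a, b\<rangle>\<close> and let \<open>a, b, c\<close> run through nets converging weak* to elements of the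
  bidual; a word such as \<open>abc\<close> denotes the iterated limit with \<open>a\<close> outermost. The topological
  centre hypothesis says that \<open>T a (bc)\<close> has the same limits in the orders \<open>abc\<close> and \<open>bac\<close>, for
  every derivation and in particular for the inner ones. Combining this for \<open>T\<close> and for the inner
  derivation of the functional \<open>T _ k\<close>, the cyclic identity \<open>T (ab) c = T a (bc) + T b (ca)\<close> shows that
  the limits of \<open>T (ab) c\<close> over \<open>ab\<close> and over \<open>c\<close> commute when \<open>c\<close> is itself a product. Weak amenability
  of the bidual makes its products dense enough (a functional vanishing on all products is zero) to
  get that the limits of \<open>T a b\<close> commute, i.e. that \<open>D\<close> is weakly compact. Then \<open>D a\<close> is weakly almost
  periodic, all orders needed agree, and \<open>D**\<close> is a derivation; it is inner, and restricting the
  implementing functional to the algebra shows that \<open>D\<close> is inner.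
\<close>

section \<open>Bounded forms and their extension to the bidual\<close>

text \<open>This and the forms below are constrained only on the carrier, so plain lambda terms can
  be nested and permuted freely; \<open>restrict\<close> turns a \<open>form1\<close> into an
  element of the dual. The bounding constants of the forms are nonnegative so that bounds can be
  multiplied.\<close>

definition linear_form :: "('k::{real_normed_field,banach}, 'a) normed_module \<Rightarrow> ('a \<Rightarrow> 'k) \<Rightarrow> bool" where
  "linear_form X h \<longleftrightarrow>
     (\<forall>x\<in>carrier X. \<forall>y\<in>carrier X. h (x \<oplus>\<^bsub>X\<^esub> y) = h x + h y) \<and>
     (\<forall>c. \<forall>x\<in>carrier X. h (c \<odot>\<^bsub>X\<^esub> x) = c * h x)"

definition form1 :: "('k::{real_normed_field,banach}, 'a) normed_module \<Rightarrow> ('a \<Rightarrow> 'k) \<Rightarrow> bool" where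
  "form1 X h \<longleftrightarrow> linear_form X h \<and> (\<exists>C\<ge>0. \<forall>x\<in>carrier X. norm (h x) \<le> C * nrm X x)"

definition form2 ::
  "('k::{real_normed_field,banach}, 'a) normed_module \<Rightarrow> ('a \<Rightarrow> 'a \<Rightarrow> 'k) \<Rightarrow> bool" where
  "form2 X F \<longleftrightarrow>
     (\<forall>x\<in>carrier X. linear_form X (F x)) \<and> (\<forall>y\<in>carrier X. linear_form X (\<lambda>x. F x y)) \<and>
     (\<exists>C\<ge>0. \<forall>x\<in>carrier X. \<forall>y\<in>carrier X. norm (F x y) \<le> C * nrm X x * nrm X y)"

definition form3 ::
  "('k::{real_normed_field,banach}, 'a) normed_module \<Rightarrow> ('a \<Rightarrow> 'a \<Rightarrow> 'a \<Rightarrow> 'k) \<Rightarrow> bool" where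
  "form3 X F \<longleftrightarrow>
     (\<forall>x\<in>carrier X. \<forall>y\<in>carrier X. linear_form X (F x y)) \<and>
     (\<forall>x\<in>carrier X. \<forall>z\<in>carrier X. linear_form X (\<lambda>y. F x y z)) \<and>
     (\<forall>y\<in>carrier X. \<forall>z\<in>carrier X. linear_form X (\<lambda>x. F x y z)) \<and>
     (\<exists>C\<ge>0. \<forall>x\<in>carrier X. \<forall>y\<in>carrier X. \<forall>z\<in>carrier X.
        norm (F x y z) \<le> C * nrm X x * nrm X y * nrm X z)"

text \<open>
  This is the limit of \<open>h\<close> along a net converging weak* to \<open>m\<close>; applied to a form in several
  variables it gives iterated limits.
\<close>

definition bidual_lim ::
  "('k::{real_normed_field,banach}, 'a) normed_module \<Rightarrow> (('a \<Rightarrow> 'k) \<Rightarrow> 'k) \<Rightarrow> ('a \<Rightarrow> 'k) \<Rightarrow> 'k" where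
  "bidual_lim X m h = m (restrict h (carrier X))"

definition bidual_embed ::
  "('k::{real_normed_field,banach}, 'a) normed_module \<Rightarrow> 'a \<Rightarrow> (('a \<Rightarrow> 'k) \<Rightarrow> 'k)" where
  "bidual_embed X x = (\<lambda>f\<in>carrier (dual X). f x)"

lemma dual_simps:
  "f \<oplus>\<^bsub>dual X\<^esub> g = (\<lambda>x\<in>carrier X. f x + g x)"
  "c \<odot>\<^bsub>dual X\<^esub> f = (\<lambda>x\<in>carrier X. c * f x)"
  "\<zero>\<^bsub>dual X\<^esub> = (\<lambda>x\<in>carrier X. 0)"
  by (simp_all add: dual_def)

context normed_space
begin

section \<open>Functionals and the dual norm\<close>

lemma smult_in_carrier: "x \<in> carrier X \<Longrightarrow> c \<odot>\<^bsub>X\<^esub> x \<in> carrier X"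
  using smult_closed[of c x] by simp

lemma form1_restrict_iff: "form1 X (restrict h (carrier X)) \<longleftrightarrow> form1 X h"
  by (simp add: form1_def linear_form_def smult_in_carrier)

lemma dual_carrier_iff: "f \<in> carrier (dual X) \<longleftrightarrow> f \<in> extensional (carrier X) \<and> form1 X f"
proof -
  have "(\<exists>C\<ge>0. \<forall>x\<in>carrier X. norm (f x) \<le> C * nrm X x)"
    if "\<forall>x\<in>carrier X. norm (f x) \<le> C * nrm X x" for C
  proof (intro exI[of _ "\<bar>C\<bar>"] conjI ballI)
    fix x assume "x \<in> carrier X"
    then have "C * nrm X x \<le> \<bar>C\<bar> * nrm X x" by (intro mult_right_mono) (auto intro: nrm_nonneg)
    then show "norm (f x) \<le> \<bar>C\<bar> * nrm X x" using that \<open>x \<in> carrier X\<close> by force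
  qed simp
  then show ?thesis
    by (auto simp: dual_def bounded_linear_map_def form1_def linear_form_def)
qed

lemma restrict_in_dual_iff: "restrict h (carrier X) \<in> carrier (dual X) \<longleftrightarrow> form1 X h"
  by (simp add: dual_carrier_iff form1_restrict_iff)

lemma form1_dual: "f \<in> carrier (dual X) \<Longrightarrow> form1 X f"
  by (simp add: dual_carrier_iff)

lemma restrict_dual: "f \<in> carrier (dual X) \<Longrightarrow> restrict f (carrier X) = f"
  by (simp add: dual_carrier_iff extensional_restrict)

lemma dual_eqI:
  "\<lbrakk>f \<in> carrier (dual X); g \<in> carrier (dual X); \<And>x. x \<in> carrier X \<Longrightarrow> f x = g x\<rbrakk> \<Longrightarrow> f = g"
  by (auto simp: dual_carrier_iff intro: extensionalityI)

text \<open>The dual norm is a supremum over the unit ball, so \<open>x\<close> is scaled to norm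
  one; boundedness of the form makes that supremum an upper bound. A vector of norm zero cannot be
  scaled and is treated apart.\<close>

lemma norm_dual_le:
  assumes f: "f \<in> carrier (dual X)" and x: "x \<in> carrier X"
  shows "norm (f x) \<le> nrm (dual X) f * nrm X x"
proof (cases "nrm X x = 0")
  case True
  then show ?thesis using form1_dual[OF f] x by (force simp: form1_def linear_form_def)
next
  case False
  then have p: "nrm X x > 0" using nrm_nonneg[OF x] by simp
  obtain C where C: "C \<ge> 0" "\<And>x. x \<in> carrier X \<Longrightarrow> norm (f x) \<le> C * nrm X x"
    using form1_dual[OF f] by (auto simp: form1_def linear_form_def)
  let ?S = "{x \<in> carrier X. nrm X x \<le> 1}"
  let ?c = "of_real (1 / nrm X x) :: 'k"
  have "norm (f y) \<le> C" if "y \<in> ?S" for y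
    using C(2)[of y] that mult_left_mono[of "nrm X y" 1 C] C(1) by simp
  then have "bdd_above ((\<lambda>x. norm (f x)) ` ?S)" by (intro bdd_aboveI2) auto
  moreover have "?c \<odot>\<^bsub>X\<^esub> x \<in> ?S"
    using nrm_smult[OF x, of ?c] p smult_in_carrier[OF x] by (auto simp: norm_divide)
  ultimately have "norm (f (?c \<odot>\<^bsub>X\<^esub> x)) \<le> (SUP x\<in>?S. norm (f x))" by (rule cSUP_upper[rotated])
  moreover have "f (?c \<odot>\<^bsub>X\<^esub> x) = ?c * f x" using form1_dual[OF f] x by (simp add: form1_def linear_form_def)
  ultimately have "norm (f x) / nrm X x \<le> nrm (dual X) f"
    using p by (simp add: dual_def norm_mult norm_divide)
  then show ?thesis using p by (simp add: field_simps)
qed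

lemma nrm_dual_le:
  assumes "C \<ge> 0" "\<And>x. x \<in> carrier X \<Longrightarrow> norm (h x) \<le> C * nrm X x"
  shows "nrm (dual X) (restrict h (carrier X)) \<le> C"
proof -
  have "norm (restrict h (carrier X) y) \<le> C" if "y \<in> carrier X" "nrm X y \<le> 1" for y
    using assms(2)[of y] that mult_left_mono[of "nrm X y" 1 C] assms(1) by simp
  \<comment> \<open>The unit ball has to be nonempty before a supremum of reals can be estimated by
    an upper bound.\<close>
  moreover have "\<zero>\<^bsub>X\<^esub> \<in> carrier X" "nrm X \<zero>\<^bsub>X\<^esub> \<le> 1" using nrm_eq_0_iff[of "\<zero>\<^bsub>X\<^esub>"] by auto
  ultimately show ?thesis unfolding dual_def by (auto intro!: cSUP_least)
qed

lemma dual_normed: "normed_space (dual X)"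
  by (rule normed_space_dual) (rule normed_space_axioms)

lemma nrm_dual_nonneg: "f \<in> carrier (dual X) \<Longrightarrow> 0 \<le> nrm (dual X) f"
  using normed_space.nrm_nonneg[OF dual_normed] .

lemma form1D:
  assumes "form1 X h" "x \<in> carrier X"
  shows "y \<in> carrier X \<Longrightarrow> h (x \<oplus>\<^bsub>X\<^esub> y) = h x + h y" "h (c \<odot>\<^bsub>X\<^esub> x) = c * h x"
  using assms by (auto simp: form1_def linear_form_def)

lemma form1_add:
  assumes "form1 X f" "form1 X g" shows "form1 X (\<lambda>x. f x + g x)"
proof -
  obtain C1 C2 where C: "C1 \<ge> 0" "C2 \<ge> 0"
    "\<And>x. x \<in> carrier X \<Longrightarrow> norm (f x) \<le> C1 * nrm X x" "\<And>x. x \<in> carrier X \<Longrightarrow> norm (g x) \<le> C2 * nrm X x"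
    using assms unfolding form1_def linear_form_def by metis
  then have "norm (f x + g x) \<le> (C1 + C2) * nrm X x" if "x \<in> carrier X" for x
    using that by (auto simp: distrib_right intro!: norm_triangle_le add_mono)
  then show ?thesis using C(1,2) assms
    by (auto simp: form1_def linear_form_def algebra_simps intro!: exI[of _ "C1 + C2"])
qed

lemma form1_cmult:
  assumes "form1 X f" shows "form1 X (\<lambda>x. c * f x)"
proof -
  obtain C1 where C: "C1 \<ge> 0" "\<And>x. x \<in> carrier X \<Longrightarrow> norm (f x) \<le> C1 * nrm X x"
    using assms unfolding form1_def linear_form_def by metis
  then have "norm (c * f x) \<le> (norm c * C1) * nrm X x" if "x \<in> carrier X" for x
    using that by (auto simp: norm_mult mult.assoc intro!: mult_left_mono)
  then show ?thesis using C(1) assms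
    by (auto simp: form1_def linear_form_def algebra_simps intro!: exI[of _ "norm c * C1"])
qed

lemma form1_diff:
  assumes "form1 X f" "form1 X g" shows "form1 X (\<lambda>x. f x - g x)"
  using form1_add[OF assms(1) form1_cmult[OF assms(2), of "-1"]] by simp

text \<open>\<open>\<ominus>\<close> goes through the additive inverse of the group, which is
  identified with the pointwise negative by uniqueness of inverses.\<close>

lemma dual_minus_apply:
  assumes f: "f \<in> carrier (dual X)" and g: "g \<in> carrier (dual X)"
  shows "f \<ominus>\<^bsub>dual X\<^esub> g = (\<lambda>x\<in>carrier X. f x - g x)"
proof -
  interpret d: normed_space "dual X" by (rule dual_normed)
  have c: "(\<lambda>x\<in>carrier X. - g x) \<in> carrier (dual X)"
    unfolding restrict_in_dual_iff using form1_cmult[OF form1_dual[OF g], of "-1"] by simp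
  have "\<ominus>\<^bsub>dual X\<^esub> g = (\<lambda>x\<in>carrier X. - g x)"
    by (rule d.minus_equality[OF _ g c]) (auto simp: dual_simps)
  then show ?thesis by (auto simp: a_minus_def dual_simps)
qed

lemma form1_linear: "form1 X h \<Longrightarrow> linear_form X h"
  by (simp add: form1_def)

section \<open>Multilinear forms and permutations of their variables\<close>

lemma form2_flip:
  assumes "form2 X F" shows "form2 X (\<lambda>x y. F y x)"
proof -
  obtain C where C: "C \<ge> 0"
    "\<And>x y. \<lbrakk>x \<in> carrier X; y \<in> carrier X\<rbrakk> \<Longrightarrow> norm (F x y) \<le> C * nrm X x * nrm X y"
    using assms unfolding form2_def by blast
  then have "norm (F y x) \<le> C * nrm X x * nrm X y" if "x \<in> carrier X" "y \<in> carrier X" for x y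
    using C(2)[of y x] that by (simp add: mult_ac)
  then show ?thesis using assms C(1) unfolding form2_def by (intro conjI exI[of _ C]) auto
qed

lemma form2_slot:
  assumes "form2 X F" "x \<in> carrier X" shows "form1 X (F x)"
proof -
  obtain C where C: "C \<ge> 0"
    "\<And>x y. \<lbrakk>x \<in> carrier X; y \<in> carrier X\<rbrakk> \<Longrightarrow> norm (F x y) \<le> C * nrm X x * nrm X y"
    using assms unfolding form2_def by blast
  then show ?thesis using assms
    unfolding form1_def form2_def by (intro conjI exI[of _ "C * nrm X x"]) (auto simp: nrm_nonneg)
qed

lemma form2_slot2: "\<lbrakk>form2 X F; y \<in> carrier X\<rbrakk> \<Longrightarrow> form1 X (\<lambda>x. F x y)"
  using form2_slot[OF form2_flip] .

lemma form3_slot: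
  assumes "form3 X F" "x \<in> carrier X" shows "form2 X (F x)"
proof -
  obtain C where C: "C \<ge> 0"
    "\<And>x y z. \<lbrakk>x \<in> carrier X; y \<in> carrier X; z \<in> carrier X\<rbrakk> \<Longrightarrow>
       norm (F x y z) \<le> C * nrm X x * nrm X y * nrm X z"
    using assms unfolding form3_def by blast
  then show ?thesis using assms
    unfolding form2_def form3_def by (intro conjI exI[of _ "C * nrm X x"]) (auto simp: nrm_nonneg)
qed

text \<open>Together with \<open>form3_swap\<close> this generates all permutations of three
  variables, so every order of limits can be brought to the one treated in
  \<open>form3_lim\<close>.\<close>

lemma form3_rotate:
  assumes "form3 X F" shows "form3 X (\<lambda>x y z. F y z x)"
proof -
  obtain C where C: "C \<ge> 0"
    "\<And>x y z. \<lbrakk>x \<in> carrier X; y \<in> carrier X; z \<in> carrier X\<rbrakk> \<Longrightarrow>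
       norm (F x y z) \<le> C * nrm X x * nrm X y * nrm X z"
    using assms unfolding form3_def by blast
  then have "norm (F y z x) \<le> C * nrm X x * nrm X y * nrm X z"
    if "x \<in> carrier X" "y \<in> carrier X" "z \<in> carrier X" for x y z
    using C(2)[of y z x] that by (simp add: mult_ac)
  then show ?thesis using assms C(1) unfolding form3_def by (intro conjI exI[of _ C]) auto
qed

lemma form3_swap:
  assumes "form3 X F" shows "form3 X (\<lambda>x y z. F y x z)"
proof -
  obtain C where C: "C \<ge> 0"
    "\<And>x y z. \<lbrakk>x \<in> carrier X; y \<in> carrier X; z \<in> carrier X\<rbrakk> \<Longrightarrow>
       norm (F x y z) \<le> C * nrm X x * nrm X y * nrm X z"
    using assms unfolding form3_def by blast
  then have "norm (F y x z) \<le> C * nrm X x * nrm X y * nrm X z"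
    if "x \<in> carrier X" "y \<in> carrier X" "z \<in> carrier X" for x y z
    using C(2)[of y x z] that by (simp add: mult_ac)
  then show ?thesis using assms C(1) unfolding form3_def by (intro conjI exI[of _ C]) auto
qed

lemma linear_form_diff:
  "\<lbrakk>linear_form X f; linear_form X g\<rbrakk> \<Longrightarrow> linear_form X (\<lambda>x. f x - g x)"
  by (simp add: linear_form_def algebra_simps)

lemma form2_diff:
  assumes "form2 X F" "form2 X G" shows "form2 X (\<lambda>x y. F x y - G x y)"
proof -
  obtain C1 C2 where C: "C1 \<ge> 0" "C2 \<ge> 0"
    "\<And>x y. \<lbrakk>x \<in> carrier X; y \<in> carrier X\<rbrakk> \<Longrightarrow> norm (F x y) \<le> C1 * nrm X x * nrm X y"
    "\<And>x y. \<lbrakk>x \<in> carrier X; y \<in> carrier X\<rbrakk> \<Longrightarrow> norm (G x y) \<le> C2 * nrm X x * nrm X y"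
    using assms unfolding form2_def by metis
  then have "norm (F x y - G x y) \<le> (C1 + C2) * nrm X x * nrm X y"
    if "x \<in> carrier X" "y \<in> carrier X" for x y
    using C(3)[OF that] C(4)[OF that] norm_triangle_ineq4[of "F x y" "G x y"]
    by (simp add: distrib_right)
  then show ?thesis using C(1,2) assms
    unfolding form2_def by (intro conjI ballI linear_form_diff exI[of _ "C1 + C2"]) auto
qed

section \<open>Limits along elements of the bidual\<close>

lemma bidual_lim_cong:
  "(\<And>x. x \<in> carrier X \<Longrightarrow> f x = g x) \<Longrightarrow> bidual_lim X m f = bidual_lim X m g"
  unfolding bidual_lim_def by (metis restrict_ext)

lemma bidual_lim_add:
  assumes "m \<in> carrier (bidual X)" "form1 X f" "form1 X g"
  shows "bidual_lim X m (\<lambda>x. f x + g x) = bidual_lim X m f + bidual_lim X m g"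
proof -
  have "restrict f (carrier X) \<oplus>\<^bsub>dual X\<^esub> restrict g (carrier X) = restrict (\<lambda>x. f x + g x) (carrier X)"
    by (auto simp: dual_simps)
  then show ?thesis
    using normed_space.form1D(1)[OF dual_normed normed_space.form1_dual[OF dual_normed assms(1)],
        of "restrict f (carrier X)" "restrict g (carrier X)"] assms(2,3)
    by (simp add: bidual_lim_def restrict_in_dual_iff)
qed

lemma bidual_lim_cmult:
  assumes "m \<in> carrier (bidual X)" "form1 X f"
  shows "bidual_lim X m (\<lambda>x. c * f x) = c * bidual_lim X m f"
proof -
  have "c \<odot>\<^bsub>dual X\<^esub> restrict f (carrier X) = restrict (\<lambda>x. c * f x) (carrier X)"
    by (auto simp: dual_simps)
  then show ?thesis
    using normed_space.form1D(2)[OF dual_normed normed_space.form1_dual[OF dual_normed assms(1)],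
        where x = "restrict f (carrier X)" and c = c] assms(2)
    by (simp add: bidual_lim_def restrict_in_dual_iff)
qed

lemma bidual_lim_diff:
  assumes "m \<in> carrier (bidual X)" "form1 X f" "form1 X g"
  shows "bidual_lim X m (\<lambda>x. f x - g x) = bidual_lim X m f - bidual_lim X m g"
  using bidual_lim_add[OF assms(1,2) form1_cmult[OF assms(3), of "-1"]]
    bidual_lim_cmult[OF assms(1,3), of "-1"] by simp

lemma norm_bidual_lim_le:
  assumes m: "m \<in> carrier (bidual X)" and f: "form1 X f"
    and C: "C \<ge> 0" "\<And>x. x \<in> carrier X \<Longrightarrow> norm (f x) \<le> C * nrm X x"
  shows "norm (bidual_lim X m f) \<le> nrm (bidual X) m * C"
proof -
  have "norm (bidual_lim X m f) \<le> nrm (bidual X) m * nrm (dual X) (restrict f (carrier X))"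
    unfolding bidual_lim_def
    using normed_space.norm_dual_le[OF dual_normed m] f by (simp add: restrict_in_dual_iff)
  also have "\<dots> \<le> nrm (bidual X) m * C"
    using C normed_space.nrm_dual_nonneg[OF dual_normed m] by (intro mult_left_mono nrm_dual_le) auto
  finally show ?thesis .
qed

lemma bidual_lim_dual: "f \<in> carrier (dual X) \<Longrightarrow> bidual_lim X m f = m f"
  by (simp add: bidual_lim_def restrict_dual)

lemma bidual_eqI:
  assumes "m \<in> carrier (bidual X)" "n \<in> carrier (bidual X)"
    "\<And>f. form1 X f \<Longrightarrow> bidual_lim X m f = bidual_lim X n f"
  shows "m = n"
  by (rule normed_space.dual_eqI[OF dual_normed assms(1,2)]) (metis assms(3) bidual_lim_dual form1_dual)

lemma bidual_embed_in_carrier: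
  assumes "x \<in> carrier X" shows "bidual_embed X x \<in> carrier (bidual X)"
proof -
  have "norm (f x) \<le> nrm X x * nrm (dual X) f" if "f \<in> carrier (dual X)" for f
    using norm_dual_le[OF that assms] by (simp add: mult.commute)
  then show ?thesis using assms
    unfolding bidual_embed_def normed_space.restrict_in_dual_iff[OF dual_normed] form1_def linear_form_def
    by (auto simp: dual_simps intro!: exI[of _ "nrm X x"] nrm_nonneg)
qed

lemma bidual_lim_embed:
  "\<lbrakk>x \<in> carrier X; form1 X f\<rbrakk> \<Longrightarrow> bidual_lim X (bidual_embed X x) f = f x"
  by (simp add: bidual_lim_def bidual_embed_def restrict_in_dual_iff)

lemma bidual_lim_bidual_add:
  "\<lbrakk>m \<in> carrier (bidual X); n \<in> carrier (bidual X); form1 X f\<rbrakk> \<Longrightarrow>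
   bidual_lim X (m \<oplus>\<^bsub>bidual X\<^esub> n) f = bidual_lim X m f + bidual_lim X n f"
  by (simp add: bidual_lim_def dual_simps restrict_in_dual_iff)

lemma bidual_lim_bidual_smult:
  "\<lbrakk>m \<in> carrier (bidual X); form1 X f\<rbrakk> \<Longrightarrow>
   bidual_lim X (c \<odot>\<^bsub>bidual X\<^esub> m) f = c * bidual_lim X m f"
  by (simp add: bidual_lim_def dual_simps restrict_in_dual_iff)

lemma linear_form_lim:
  assumes "m \<in> carrier (bidual X)" "\<And>x. x \<in> carrier X \<Longrightarrow> form1 X (F x)"
    "\<And>y. y \<in> carrier X \<Longrightarrow> linear_form X (\<lambda>x. F x y)"
  shows "linear_form X (\<lambda>x. bidual_lim X m (F x))"
  unfolding linear_form_def
proof (intro conjI ballI allI)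
  fix x y assume xy: "x \<in> carrier X" "y \<in> carrier X"
  have "bidual_lim X m (F (x \<oplus>\<^bsub>X\<^esub> y)) = bidual_lim X m (\<lambda>z. F x z + F y z)"
    by (rule bidual_lim_cong) (use assms(3) xy in \<open>simp add: linear_form_def\<close>)
  then show "bidual_lim X m (F (x \<oplus>\<^bsub>X\<^esub> y)) = bidual_lim X m (F x) + bidual_lim X m (F y)"
    using bidual_lim_add[OF assms(1)] assms(2) xy by simp
next
  fix c x assume x: "x \<in> carrier X"
  have "bidual_lim X m (F (c \<odot>\<^bsub>X\<^esub> x)) = bidual_lim X m (\<lambda>z. c * F x z)"
    by (rule bidual_lim_cong) (use assms(3) x in \<open>simp add: linear_form_def\<close>)
  then show "bidual_lim X m (F (c \<odot>\<^bsub>X\<^esub> x)) = c * bidual_lim X m (F x)"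
    using bidual_lim_cmult[OF assms(1)] assms(2) x by simp
qed

text \<open>The constant \<open>C\<close> is chosen before \<open>m\<close>, so the estimate is
  uniform over the bidual; this is what later bounds iterated limits as functions of
  \<open>m\<close>.\<close>

lemma form2_lim_bound:
  assumes F: "form2 X F"
  obtains C where "C \<ge> 0"
    "\<And>m x. \<lbrakk>m \<in> carrier (bidual X); x \<in> carrier X\<rbrakk> \<Longrightarrow>
       norm (bidual_lim X m (F x)) \<le> (nrm (bidual X) m * C) * nrm X x"
proof -
  obtain C where C: "C \<ge> 0"
    "\<And>x y. \<lbrakk>x \<in> carrier X; y \<in> carrier X\<rbrakk> \<Longrightarrow> norm (F x y) \<le> C * nrm X x * nrm X y"
    using F unfolding form2_def by blast
  show ?thesis
  proof (rule that[OF C(1)])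
    fix m x assume m: "m \<in> carrier (bidual X)" and x: "x \<in> carrier X"
    have "norm (bidual_lim X m (F x)) \<le> nrm (bidual X) m * (C * nrm X x)"
      using C x by (intro norm_bidual_lim_le[OF m form2_slot[OF F x]]) (auto simp: nrm_nonneg)
    then show "norm (bidual_lim X m (F x)) \<le> (nrm (bidual X) m * C) * nrm X x"
      by (simp add: mult.assoc)
  qed
qed

lemma form2_lim:
  assumes m: "m \<in> carrier (bidual X)" and F: "form2 X F"
  shows "form1 X (\<lambda>x. bidual_lim X m (F x))"
proof -
  obtain C where C: "C \<ge> 0"
    "\<And>m x. \<lbrakk>m \<in> carrier (bidual X); x \<in> carrier X\<rbrakk> \<Longrightarrow>
       norm (bidual_lim X m (F x)) \<le> (nrm (bidual X) m * C) * nrm X x"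
    using form2_lim_bound[OF F] by blast
  moreover have "linear_form X (\<lambda>x. bidual_lim X m (F x))"
    using F form2_slot[OF F] by (intro linear_form_lim[OF m]) (auto simp: form2_def)
  moreover have "0 \<le> nrm (bidual X) m * C"
    using C(1) normed_space.nrm_dual_nonneg[OF dual_normed m] by simp
  ultimately show ?thesis unfolding form1_def using m by blast
qed

text \<open>By this and \<open>form2_lim\<close> each limit removes one variable and leaves a
  bounded form, so nested limits are again limits of bounded forms.\<close>

lemma form3_lim:
  assumes m: "m \<in> carrier (bidual X)" and F: "form3 X F"
  shows "form2 X (\<lambda>x y. bidual_lim X m (F x y))"
proof -
  obtain C where C: "C \<ge> 0"
    "\<And>x y z. \<lbrakk>x \<in> carrier X; y \<in> carrier X; z \<in> carrier X\<rbrakk> \<Longrightarrow>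
       norm (F x y z) \<le> C * nrm X x * nrm X y * nrm X z"
    using F unfolding form3_def by blast
  have "norm (bidual_lim X m (F x y)) \<le> (nrm (bidual X) m * C) * nrm X x * nrm X y"
    if "x \<in> carrier X" "y \<in> carrier X" for x y
  proof -
    have "norm (bidual_lim X m (F x y)) \<le> nrm (bidual X) m * (C * nrm X x * nrm X y)"
      using C that
      by (intro norm_bidual_lim_le[OF m form2_slot[OF form3_slot[OF F]]]) (auto simp: nrm_nonneg)
    then show ?thesis by (simp add: mult_ac)
  qed
  moreover have "form1 X (\<lambda>y. bidual_lim X m (F x y))" if "x \<in> carrier X" for x
    using form2_lim[OF m form3_slot[OF F that]] .
  moreover have "form1 X (\<lambda>x. bidual_lim X m (F x y))" if "y \<in> carrier X" for y
    using form2_lim[OF m form3_slot[OF form3_swap[OF F] that]] .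
  moreover have "0 \<le> nrm (bidual X) m * C"
    using C(1) normed_space.nrm_dual_nonneg[OF dual_normed m] by simp
  ultimately show ?thesis
    unfolding form2_def by (intro conjI ballI exI[of _ "nrm (bidual X) m * C"] form1_linear)
qed

lemma form1_bidual:
  assumes "\<And>m n. \<lbrakk>m \<in> carrier (bidual X); n \<in> carrier (bidual X)\<rbrakk> \<Longrightarrow>
      \<Phi> (m \<oplus>\<^bsub>bidual X\<^esub> n) = \<Phi> m + \<Phi> n"
    "\<And>c m. m \<in> carrier (bidual X) \<Longrightarrow> \<Phi> (c \<odot>\<^bsub>bidual X\<^esub> m) = c * \<Phi> m"
    "C \<ge> 0" "\<And>m. m \<in> carrier (bidual X) \<Longrightarrow> norm (\<Phi> m) \<le> C * nrm (bidual X) m"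
  shows "form1 (bidual X) \<Phi>"
  unfolding form1_def linear_form_def using assms by (intro conjI ballI allI exI[of _ C]) auto

lemma form1_bidual_lim:
  assumes f: "form1 X f" shows "form1 (bidual X) (\<lambda>m. bidual_lim X m f)"
proof -
  obtain C where C: "C \<ge> 0" "\<And>x. x \<in> carrier X \<Longrightarrow> norm (f x) \<le> C * nrm X x"
    using f by (auto simp: form1_def)
  show ?thesis
    by (rule form1_bidual[OF _ _ C(1)])
      (use norm_bidual_lim_le[OF _ f C] in
        \<open>auto simp: bidual_lim_bidual_add bidual_lim_bidual_smult f mult.commute\<close>)
qed

text \<open>Here the element of the inner limit varies while the outer one is fixed. Linearity in
  \<open>m\<close> passes through the outer limit, and the estimate of
  \<open>form2_lim_bound\<close> is proportional to the norm of \<open>m\<close>.\<close>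

lemma form1_bidual_lim_lim:
  assumes F: "form2 X F" and p: "p \<in> carrier (bidual X)"
  shows "form1 (bidual X) (\<lambda>m. bidual_lim X p (\<lambda>y. bidual_lim X m (F y)))"
proof -
  obtain C where C: "C \<ge> 0"
    "\<And>m x. \<lbrakk>m \<in> carrier (bidual X); x \<in> carrier X\<rbrakk> \<Longrightarrow>
       norm (bidual_lim X m (F x)) \<le> (nrm (bidual X) m * C) * nrm X x"
    using form2_lim_bound[OF F] by blast
  have nn: "0 \<le> nrm (bidual X) m" if "m \<in> carrier (bidual X)" for m
    using normed_space.nrm_dual_nonneg[OF dual_normed that] .
  show ?thesis
  proof (rule form1_bidual)
    fix m n assume mn: "m \<in> carrier (bidual X)" "n \<in> carrier (bidual X)"
    have "bidual_lim X p (\<lambda>y. bidual_lim X (m \<oplus>\<^bsub>bidual X\<^esub> n) (F y)) =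
        bidual_lim X p (\<lambda>y. bidual_lim X m (F y) + bidual_lim X n (F y))"
      by (rule bidual_lim_cong) (simp add: bidual_lim_bidual_add mn form2_slot[OF F])
    then show "bidual_lim X p (\<lambda>y. bidual_lim X (m \<oplus>\<^bsub>bidual X\<^esub> n) (F y)) =
        bidual_lim X p (\<lambda>y. bidual_lim X m (F y)) + bidual_lim X p (\<lambda>y. bidual_lim X n (F y))"
      by (simp add: bidual_lim_add[OF p form2_lim[OF _ F] form2_lim[OF _ F]] mn)
  next
    fix c m assume m: "m \<in> carrier (bidual X)"
    have "bidual_lim X p (\<lambda>y. bidual_lim X (c \<odot>\<^bsub>bidual X\<^esub> m) (F y)) =
        bidual_lim X p (\<lambda>y. c * bidual_lim X m (F y))"
      by (rule bidual_lim_cong) (simp add: bidual_lim_bidual_smult m form2_slot[OF F])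
    then show "bidual_lim X p (\<lambda>y. bidual_lim X (c \<odot>\<^bsub>bidual X\<^esub> m) (F y)) =
        c * bidual_lim X p (\<lambda>y. bidual_lim X m (F y))"
      by (simp add: bidual_lim_cmult[OF p form2_lim[OF _ F]] m)
  next
    show "0 \<le> nrm (bidual X) p * C" using C(1) nn[OF p] by simp
    fix m assume m: "m \<in> carrier (bidual X)"
    have "norm (bidual_lim X p (\<lambda>y. bidual_lim X m (F y))) \<le> nrm (bidual X) p * (nrm (bidual X) m * C)"
      using C m nn[OF m] by (intro norm_bidual_lim_le[OF p form2_lim[OF m F]]) auto
    then show "norm (bidual_lim X p (\<lambda>y. bidual_lim X m (F y))) \<le> nrm (bidual X) p * C * nrm (bidual X) m"
      by (simp add: mult_ac)
  qed
qed

section \<open>Convolutions and weak* continuous functionals\<close>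

lemma dual_add_apply: "\<lbrakk>x \<in> carrier X\<rbrakk> \<Longrightarrow> (f \<oplus>\<^bsub>dual X\<^esub> g) x = f x + g x"
  by (simp add: dual_simps)

lemma dual_smult_apply: "\<lbrakk>x \<in> carrier X\<rbrakk> \<Longrightarrow> (c \<odot>\<^bsub>dual X\<^esub> f) x = c * f x"
  by (simp add: dual_simps)

text \<open>\<open>P\<close> stands for the product of an algebra or for its opposite, so that both
  Arens products are covered. Each limit contributes the norm of its bidual element as a
  factor.\<close>

lemma convolution_bound:
  assumes m: "m \<in> carrier (bidual X)" and n: "n \<in> carrier (bidual X)"
    and P: "\<And>x y. \<lbrakk>x \<in> carrier X; y \<in> carrier X\<rbrakk> \<Longrightarrow> P x y \<in> carrier X"
    and form: "\<And>h. form1 X h \<Longrightarrow> form2 X (\<lambda>x y. h (P x y))"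
    and nrm: "\<And>x y. \<lbrakk>x \<in> carrier X; y \<in> carrier X\<rbrakk> \<Longrightarrow> nrm X (P x y) \<le> nrm X x * nrm X y"
    and f: "f \<in> carrier (dual X)"
  shows "norm (bidual_lim X m (\<lambda>x. bidual_lim X n (\<lambda>y. f (P x y))))
    \<le> nrm (bidual X) m * nrm (bidual X) n * nrm (dual X) f"
proof -
  have F: "form2 X (\<lambda>x y. f (P x y))" using form form1_dual[OF f] by blast
  have nf: "0 \<le> nrm (dual X) f" using nrm_dual_nonneg[OF f] .
  have nn: "0 \<le> nrm (bidual X) n" using normed_space.nrm_dual_nonneg[OF dual_normed n] .
  have "norm (f (P x y)) \<le> nrm (dual X) f * nrm X x * nrm X y"
    if "x \<in> carrier X" "y \<in> carrier X" for x y
    using norm_dual_le[OF f P[OF that]] mult_left_mono[OF nrm[OF that] nf] by (simp add: mult.assoc)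
  then have "norm (bidual_lim X n (\<lambda>y. f (P x y))) \<le> nrm (bidual X) n * (nrm (dual X) f * nrm X x)"
    if "x \<in> carrier X" for x
    using nf nrm_nonneg that by (intro norm_bidual_lim_le[OF n form2_slot[OF F that]]) auto
  then have "norm (bidual_lim X n (\<lambda>y. f (P x y))) \<le> (nrm (bidual X) n * nrm (dual X) f) * nrm X x"
    if "x \<in> carrier X" for x
    using that by (simp add: mult.assoc)
  then have "norm (bidual_lim X m (\<lambda>x. bidual_lim X n (\<lambda>y. f (P x y))))
      \<le> nrm (bidual X) m * (nrm (bidual X) n * nrm (dual X) f)"
    using nf nn by (intro norm_bidual_lim_le[OF m form2_lim[OF n F]]) auto
  then show ?thesis by (simp add: mult.assoc)
qed

lemma convolution_in_bidual:
  assumes m: "m \<in> carrier (bidual X)" and n: "n \<in> carrier (bidual X)"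
    and P: "\<And>x y. \<lbrakk>x \<in> carrier X; y \<in> carrier X\<rbrakk> \<Longrightarrow> P x y \<in> carrier X"
    and form: "\<And>h. form1 X h \<Longrightarrow> form2 X (\<lambda>x y. h (P x y))"
    and nrm: "\<And>x y. \<lbrakk>x \<in> carrier X; y \<in> carrier X\<rbrakk> \<Longrightarrow> nrm X (P x y) \<le> nrm X x * nrm X y"
  shows "(\<lambda>f\<in>carrier (dual X). bidual_lim X m (\<lambda>x. bidual_lim X n (\<lambda>y. f (P x y))))
      \<in> carrier (bidual X)"
proof -
  have F: "form2 X (\<lambda>x y. f (P x y))" if "f \<in> carrier (dual X)" for f
    using form form1_dual[OF that] by blast
  show ?thesis
    unfolding normed_space.restrict_in_dual_iff[OF dual_normed] form1_def linear_form_def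
  proof (intro conjI ballI allI)
    fix f g assume fg: "f \<in> carrier (dual X)" "g \<in> carrier (dual X)"
    have "bidual_lim X m (\<lambda>x. bidual_lim X n (\<lambda>y. (f \<oplus>\<^bsub>dual X\<^esub> g) (P x y))) =
        bidual_lim X m (\<lambda>x. bidual_lim X n (\<lambda>y. f (P x y) + g (P x y)))"
      by (intro bidual_lim_cong) (simp add: dual_simps P)
    also have "\<dots> = bidual_lim X m (\<lambda>x. bidual_lim X n (\<lambda>y. f (P x y)) + bidual_lim X n (\<lambda>y. g (P x y)))"
      by (intro bidual_lim_cong bidual_lim_add[OF n]) (simp_all add: form2_slot[OF F] fg)
    also have "\<dots> = bidual_lim X m (\<lambda>x. bidual_lim X n (\<lambda>y. f (P x y)))
        + bidual_lim X m (\<lambda>x. bidual_lim X n (\<lambda>y. g (P x y)))"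
      by (intro bidual_lim_add[OF m] form2_lim[OF n] F fg)
    finally show "bidual_lim X m (\<lambda>x. bidual_lim X n (\<lambda>y. (f \<oplus>\<^bsub>dual X\<^esub> g) (P x y))) = \<dots>" .
  next
    fix c f assume f: "f \<in> carrier (dual X)"
    have "bidual_lim X m (\<lambda>x. bidual_lim X n (\<lambda>y. (c \<odot>\<^bsub>dual X\<^esub> f) (P x y))) =
        bidual_lim X m (\<lambda>x. bidual_lim X n (\<lambda>y. c * f (P x y)))"
      by (intro bidual_lim_cong) (simp add: dual_simps P)
    also have "\<dots> = bidual_lim X m (\<lambda>x. c * bidual_lim X n (\<lambda>y. f (P x y)))"
      by (intro bidual_lim_cong bidual_lim_cmult[OF n]) (simp_all add: form2_slot[OF F] f)
    also have "\<dots> = c * bidual_lim X m (\<lambda>x. bidual_lim X n (\<lambda>y. f (P x y)))"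
      by (intro bidual_lim_cmult[OF m] form2_lim[OF n] F f)
    finally show "bidual_lim X m (\<lambda>x. bidual_lim X n (\<lambda>y. (c \<odot>\<^bsub>dual X\<^esub> f) (P x y))) = \<dots>" .
  next
    have "0 \<le> nrm (bidual X) m * nrm (bidual X) n"
      using normed_space.nrm_dual_nonneg[OF dual_normed] m n by simp
    then show "\<exists>C\<ge>0. \<forall>f\<in>carrier (dual X).
        norm (bidual_lim X m (\<lambda>x. bidual_lim X n (\<lambda>y. f (P x y)))) \<le> C * nrm (dual X) f"
      using convolution_bound[OF m n P form nrm]
      by (intro exI[of _ "nrm (bidual X) m * nrm (bidual X) n"]) auto
  qed
qed

text \<open>A functional vanishing on the common kernel of finitely many evaluations is a
  combination of them, and a combination of evaluations is evaluation at the same combination of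
  points. The induction removes one evaluation at a time.\<close>

lemma linear_functional_finite_intersection:
  assumes "finite S" "S \<subseteq> carrier X" "linear_form (dual X) G"
    and "\<And>f. \<lbrakk>f \<in> carrier (dual X); \<forall>s\<in>S. f s = 0\<rbrakk> \<Longrightarrow> G f = 0"
  shows "\<exists>x\<in>carrier X. \<forall>f\<in>carrier (dual X). G f = f x"
  using assms
proof (induction S arbitrary: G rule: finite_induct)
  case empty
  then have "G f = f \<zero>\<^bsub>X\<^esub>" if "f \<in> carrier (dual X)" for f
    using that form1D(1)[OF form1_dual[OF that], of "\<zero>\<^bsub>X\<^esub>" "\<zero>\<^bsub>X\<^esub>"] by simp
  then show ?case by blast
next
  case (insert s S)
  interpret d: normed_space "dual X" by (rule dual_normed)
  have s: "s \<in> carrier X" and S: "S \<subseteq> carrier X" using insert.prems by auto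
  have Gadd: "G (f \<oplus>\<^bsub>dual X\<^esub> g) = G f + G g" if "f \<in> carrier (dual X)" "g \<in> carrier (dual X)" for f g
    using insert.prems(2) that by (simp add: linear_form_def)
  have Gsm: "G (c \<odot>\<^bsub>dual X\<^esub> f) = c * G f" if "f \<in> carrier (dual X)" for c f
    using insert.prems(2) that by (simp add: linear_form_def)
  show ?case
  proof (cases "\<forall>f\<in>carrier (dual X). (\<forall>t\<in>S. f t = 0) \<longrightarrow> f s = 0")
    \<comment> \<open>Evaluation at \<open>s\<close> vanishes on the common kernel of
      \<open>S\<close>, so the condition on \<open>G\<close> for \<open>insert s S\<close> already
      gives the one for \<open>S\<close>.\<close>
    case True
    then show ?thesis using insert.IH[OF S insert.prems(2)] insert.prems(3) by simp
  next
    case False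
    then obtain f1 where f1: "f1 \<in> carrier (dual X)" "\<forall>t\<in>S. f1 t = 0" "f1 s \<noteq> 0" by blast
    \<comment> \<open>\<open>f0\<close> is killed by \<open>S\<close> and takes the value 1 at
      \<open>s\<close>. Subtracting \<open>G f0\<close> times evaluation at \<open>s\<close> from
      \<open>G\<close> therefore leaves a functional \<open>G'\<close> satisfying the condition for
      \<open>S\<close>; the correction is undone by adding \<open>G f0\<close> times
      \<open>s\<close> to the representing point.\<close>
    define f0 where "f0 = (1 / f1 s) \<odot>\<^bsub>dual X\<^esub> f1"
    have "f0 \<in> carrier (dual X)" unfolding f0_def by (rule d.smult_in_carrier[OF f1(1)])
    moreover have "\<And>t. t \<in> S \<Longrightarrow> f0 t = 0" "f0 s = 1"
      using f1 S s by (auto simp: f0_def dual_simps subset_iff)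
    ultimately have f0: "f0 \<in> carrier (dual X)" "\<And>t. t \<in> S \<Longrightarrow> f0 t = 0" "f0 s = 1" by auto
    define G' where "G' f = G f - f s * G f0" for f
    have lin: "linear_form (dual X) G'"
      unfolding linear_form_def G'_def using s
      by (auto simp: Gadd Gsm dual_add_apply dual_smult_apply algebra_simps)
    have "G' f = 0" if f: "f \<in> carrier (dual X)" "\<forall>t\<in>S. f t = 0" for f
    proof -
      have "G (f \<oplus>\<^bsub>dual X\<^esub> (- f s) \<odot>\<^bsub>dual X\<^esub> f0) = 0"
      proof (rule insert.prems(3))
        show "f \<oplus>\<^bsub>dual X\<^esub> (- f s) \<odot>\<^bsub>dual X\<^esub> f0 \<in> carrier (dual X)"
          using f f0 d.smult_in_carrier by blast
        show "\<forall>t\<in>insert s S. (f \<oplus>\<^bsub>dual X\<^esub> (- f s) \<odot>\<^bsub>dual X\<^esub> f0) t = 0"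
          using f f0 s S by (auto simp: dual_simps subset_iff)
      qed
      then show ?thesis using f f0 d.smult_in_carrier by (simp add: Gadd Gsm G'_def)
    qed
    then obtain x where x: "x \<in> carrier X" "\<And>f. f \<in> carrier (dual X) \<Longrightarrow> G' f = f x"
      using insert.IH[OF S lin] by blast
    have "G f = f (x \<oplus>\<^bsub>X\<^esub> G f0 \<odot>\<^bsub>X\<^esub> s)" if f: "f \<in> carrier (dual X)" for f
      using x(2)[OF f] x(1) s smult_in_carrier[OF s]
      by (simp add: G'_def form1D[OF form1_dual[OF f]] algebra_simps)
    then show ?thesis using x(1) s smult_in_carrier[OF s] by (intro bexI[of _ "x \<oplus>\<^bsub>X\<^esub> G f0 \<odot>\<^bsub>X\<^esub> s"]) auto
  qed
qed

text \<open>Continuity at zero involves only finitely many points, and \<open>G\<close> vanishes on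
  every functional killed by these points, so \<open>linear_functional_finite_intersection\<close>
  applies.\<close>

lemma weak_star_continuous_functional:
  assumes lin: "linear_form (dual X) G"
    and cont: "continuous_map (weak_star X) euclidean G"
  shows "\<exists>x\<in>carrier X. \<forall>f\<in>carrier (dual X). G f = f x"
proof -
  interpret d: normed_space "dual X" by (rule dual_normed)
  have top: "topspace (weak_star X) = carrier (dual X)"
    by (auto simp: weak_star_def dual_carrier_iff PiE_def)
  let ?z = "\<zero>\<^bsub>dual X\<^esub>"
  have z: "?z \<in> carrier (dual X)" by simp
  have "G (?z \<oplus>\<^bsub>dual X\<^esub> ?z) = G ?z + G ?z" using lin z unfolding linear_form_def by blast
  then have Gz: "G ?z = 0" by simp
  have "openin (weak_star X) {f \<in> carrier (dual X). norm (G f) < 1}"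
    using openin_continuous_map_preimage[OF cont, of "ball 0 1"] by (simp add: top)
  then obtain W where W: "openin (product_topology (\<lambda>_. euclidean) (carrier X)) W"
    "{f \<in> carrier (dual X). norm (G f) < 1} = W \<inter> carrier (dual X)"
    unfolding weak_star_def openin_subtopology by blast
  have "?z \<in> {f \<in> carrier (dual X). norm (G f) < 1}" using z Gz by simp
  then have "?z \<in> W" unfolding W(2) by blast
  \<comment> \<open>A basic neighbourhood of zero in the product topology restricts only finitely
    many coordinates; they become the set \<open>S\<close>.\<close>
  then have "\<exists>U. finite {i \<in> carrier X. U i \<noteq> topspace (euclidean :: 'k topology)} \<and>
      (\<forall>i\<in>carrier X. openin euclidean (U i)) \<and> ?z \<in> Pi\<^sub>E (carrier X) U \<and> Pi\<^sub>E (carrier X) U \<subseteq> W"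
    using W(1) unfolding openin_product_topology_alt by (rule bspec[rotated])
  then obtain U where U: "finite {i \<in> carrier X. U i \<noteq> UNIV}"
    "?z \<in> Pi\<^sub>E (carrier X) U" "Pi\<^sub>E (carrier X) U \<subseteq> W"
    unfolding topspace_euclidean by blast
  define S where "S = {i \<in> carrier X. U i \<noteq> UNIV}"
  have "G f = 0" if f: "f \<in> carrier (dual X)" "\<forall>s\<in>S. f s = 0" for f
  proof (rule ccontr)
    assume "G f \<noteq> 0"
    \<comment> \<open>Functionals vanishing on \<open>S\<close> stay in the neighbourhood under
      scaling; scaling to \<open>G g = 1\<close> contradicts the bound \<open>norm (G g) < 1\<close>
      valid there.\<close>
    define g where "g = (1 / G f) \<odot>\<^bsub>dual X\<^esub> f"
    have g: "g \<in> carrier (dual X)" using f d.smult_in_carrier by (simp add: g_def)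
    have "g i \<in> U i" if "i \<in> carrier X" for i
    proof (cases "U i = UNIV")
      case False
      then have "g i = ?z i" using that f(2) by (simp add: S_def g_def dual_simps)
      then show ?thesis using PiE_mem[OF U(2) that] by simp
    qed simp
    then have "g \<in> Pi\<^sub>E (carrier X) U" using g by (auto simp: dual_carrier_iff PiE_def)
    then have "norm (G g) < 1" using U(3) W(2) g by blast
    moreover have "G g = 1" using lin f(1) \<open>G f \<noteq> 0\<close> by (simp add: g_def linear_form_def)
    ultimately show False by simp
  qed
  then show ?thesis
    using linear_functional_finite_intersection[OF _ _ lin, of S] U(1) by (auto simp: S_def)
qed

end

section \<open>The Arens products\<close>

text \<open>The second Arens product, with the limits in the opposite order. It serves to read an
  iterated limit of a word \<open>x \<otimes> y\<close> with \<open>y\<close> outermost as a limit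
  along a single bidual element.\<close>

definition arens_second ::
  "('k::{real_normed_field,banach}, 'a) normed_module \<Rightarrow> (('a \<Rightarrow> 'k) \<Rightarrow> 'k) \<Rightarrow> (('a \<Rightarrow> 'k) \<Rightarrow> 'k) \<Rightarrow> (('a \<Rightarrow> 'k) \<Rightarrow> 'k)" where
  "arens_second A m n = (\<lambda>f\<in>carrier (dual A). bidual_lim A n (\<lambda>y. bidual_lim A m (\<lambda>x. f (x \<otimes>\<^bsub>A\<^esub> y))))"

lemma arens_mult_apply:
  "m \<otimes>\<^bsub>arens A\<^esub> n = (\<lambda>f\<in>carrier (dual A). bidual_lim A m (\<lambda>x. bidual_lim A n (\<lambda>y. f (x \<otimes>\<^bsub>A\<^esub> y))))"
  by (simp add: arens_def bilinear_triadjoint_def bilinear_adjoint_def bidual_lim_def fun_eq_iff)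

lemma arens_simps:
  "carrier (arens A) = carrier (bidual A)" "dual (arens A) = dual (bidual A)"
  "nrm (arens A) = nrm (bidual A)" "m \<oplus>\<^bsub>arens A\<^esub> n = m \<oplus>\<^bsub>bidual A\<^esub> n" "c \<odot>\<^bsub>arens A\<^esub> m = c \<odot>\<^bsub>bidual A\<^esub> m"
  by (simp_all add: arens_def dual_def bounded_linear_map_def)

context banach_algebra
begin

lemma form2_mult:
  assumes h: "form1 A h" shows "form2 A (\<lambda>x y. h (x \<otimes>\<^bsub>A\<^esub> y))"
proof -
  obtain C where C: "C \<ge> 0" "\<And>x. x \<in> carrier A \<Longrightarrow> norm (h x) \<le> C * nrm A x"
    using h by (auto simp: form1_def)
  have "norm (h (x \<otimes>\<^bsub>A\<^esub> y)) \<le> C * nrm A x * nrm A y" if "x \<in> carrier A" "y \<in> carrier A" for x y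
    using C(2)[OF mult_closed[OF that]] mult_left_mono[OF nrm_mult[OF that] C(1)] by (simp add: mult.assoc)
  then show ?thesis using C(1)
    unfolding form2_def linear_form_def
    by (intro conjI ballI allI exI[of _ C])
       (auto simp: form1D[OF h] mult_closed mult_add_left mult_add_right mult_smult_left mult_smult_right)
qed

lemma form3_mult_left:
  assumes F: "form2 A F" shows "form3 A (\<lambda>x y z. F (x \<otimes>\<^bsub>A\<^esub> y) z)"
proof -
  obtain C where C: "C \<ge> 0"
    "\<And>x y. \<lbrakk>x \<in> carrier A; y \<in> carrier A\<rbrakk> \<Longrightarrow> norm (F x y) \<le> C * nrm A x * nrm A y"
    using F unfolding form2_def by blast
  have b: "norm (F (x \<otimes>\<^bsub>A\<^esub> y) z) \<le> C * nrm A x * nrm A y * nrm A z"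
    if xyz: "x \<in> carrier A" "y \<in> carrier A" "z \<in> carrier A" for x y z
  proof -
    have "C * nrm A (x \<otimes>\<^bsub>A\<^esub> y) * nrm A z \<le> C * (nrm A x * nrm A y) * nrm A z"
      using xyz C(1) by (intro mult_right_mono mult_left_mono nrm_mult nrm_nonneg)
    then show ?thesis using C(2)[of "x \<otimes>\<^bsub>A\<^esub> y" z] xyz by (simp add: mult_closed mult.assoc)
  qed
  have "form2 A (\<lambda>x y. F (x \<otimes>\<^bsub>A\<^esub> y) z)" if "z \<in> carrier A" for z
    using form2_mult[OF form2_slot2[OF F that]] .
  moreover have "linear_form A (F (x \<otimes>\<^bsub>A\<^esub> y))" if "x \<in> carrier A" "y \<in> carrier A" for x y
    using F mult_closed[OF that] by (simp add: form2_def)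
  ultimately show ?thesis using b C(1)
    unfolding form3_def form2_def by (intro conjI ballI exI[of _ C]) auto
qed

lemma form3_mult_right: "form2 A F \<Longrightarrow> form3 A (\<lambda>x y z. F x (y \<otimes>\<^bsub>A\<^esub> z))"
  using form3_rotate[OF form3_mult_left[OF form2_flip]] .

lemma arens_closed:
  "\<lbrakk>m \<in> carrier (bidual A); n \<in> carrier (bidual A)\<rbrakk> \<Longrightarrow> m \<otimes>\<^bsub>arens A\<^esub> n \<in> carrier (bidual A)"
  unfolding arens_mult_apply
  by (rule convolution_in_bidual) (auto simp: mult_closed form2_mult nrm_mult)

lemma arens_second_closed:
  assumes "m \<in> carrier (bidual A)" "n \<in> carrier (bidual A)"
  shows "arens_second A m n \<in> carrier (bidual A)"
proof -
  have "nrm A (x \<otimes>\<^bsub>A\<^esub> y) \<le> nrm A y * nrm A x" if "x \<in> carrier A" "y \<in> carrier A" for x y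
    using nrm_mult[OF that] by (simp only: mult.commute)
  then show ?thesis
    unfolding arens_second_def
    by (intro convolution_in_bidual[where P = "\<lambda>y x. x \<otimes>\<^bsub>A\<^esub> y"])
       (simp_all only: assms mult_closed form2_flip[OF form2_mult])
qed

text \<open>Used in both directions: to unfold a limit along a product, and to merge two nested
  limits of a word into one, so that an interchange of two limits applies to a longer word.\<close>

lemma bidual_lim_arens:
  assumes "form1 A h"
  shows "bidual_lim A (m \<otimes>\<^bsub>arens A\<^esub> n) h = bidual_lim A m (\<lambda>x. bidual_lim A n (\<lambda>y. h (x \<otimes>\<^bsub>A\<^esub> y)))"
proof -
  have "bidual_lim A (m \<otimes>\<^bsub>arens A\<^esub> n) h =
      bidual_lim A m (\<lambda>x. bidual_lim A n (\<lambda>y. restrict h (carrier A) (x \<otimes>\<^bsub>A\<^esub> y)))"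
    using assms unfolding arens_mult_apply by (simp add: bidual_lim_def restrict_in_dual_iff)
  also have "\<dots> = bidual_lim A m (\<lambda>x. bidual_lim A n (\<lambda>y. h (x \<otimes>\<^bsub>A\<^esub> y)))"
    by (intro bidual_lim_cong) (simp add: mult_closed)
  finally show ?thesis .
qed

lemma bidual_lim_arens_second:
  assumes "form1 A h"
  shows "bidual_lim A (arens_second A m n) h = bidual_lim A n (\<lambda>y. bidual_lim A m (\<lambda>x. h (x \<otimes>\<^bsub>A\<^esub> y)))"
proof -
  have "bidual_lim A (arens_second A m n) h =
      bidual_lim A n (\<lambda>y. bidual_lim A m (\<lambda>x. restrict h (carrier A) (x \<otimes>\<^bsub>A\<^esub> y)))"
    using assms unfolding arens_second_def by (simp add: bidual_lim_def restrict_in_dual_iff)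
  also have "\<dots> = bidual_lim A n (\<lambda>y. bidual_lim A m (\<lambda>x. h (x \<otimes>\<^bsub>A\<^esub> y)))"
    by (intro bidual_lim_cong) (simp add: mult_closed)
  finally show ?thesis .
qed

lemma nrm_arens_le:
  assumes m: "m \<in> carrier (bidual A)" and n: "n \<in> carrier (bidual A)"
  shows "nrm (bidual A) (m \<otimes>\<^bsub>arens A\<^esub> n) \<le> nrm (bidual A) m * nrm (bidual A) n"
proof -
  have "0 \<le> nrm (bidual A) m * nrm (bidual A) n"
    using normed_space.nrm_dual_nonneg[OF dual_normed] m n by simp
  moreover have "norm (bidual_lim A m (\<lambda>x. bidual_lim A n (\<lambda>y. f (x \<otimes>\<^bsub>A\<^esub> y))))
      \<le> nrm (bidual A) m * nrm (bidual A) n * nrm (dual A) f" if "f \<in> carrier (dual A)" for f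
    by (rule convolution_bound[where P = "\<lambda>x y. x \<otimes>\<^bsub>A\<^esub> y"])
       (simp_all only: m n that mult_closed form2_mult nrm_mult)
  ultimately show ?thesis
    unfolding arens_mult_apply by (rule normed_space.nrm_dual_le[OF dual_normed])
qed

end

section \<open>Derivations and the topological centre\<close>

text \<open>\<open>T a b\<close> is the value of \<open>D a\<close> at \<open>b\<close>. Since the
  left action of \<open>a\<close> on \<open>f\<close> takes \<open>c\<close> to
  \<open>f (c \<otimes> a)\<close>, the derivation rule evaluated at \<open>c\<close> becomes this
  identity, with the factors rotated in the last term.\<close>

definition derivation_form :: "('k::{real_normed_field,banach}, 'a) normed_module \<Rightarrow> ('a \<Rightarrow> 'a \<Rightarrow> 'k) \<Rightarrow> bool" where
  "derivation_form A T \<longleftrightarrow> form2 A T \<and>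
     (\<forall>a\<in>carrier A. \<forall>b\<in>carrier A. \<forall>c\<in>carrier A.
        T (a \<otimes>\<^bsub>A\<^esub> b) c = T a (b \<otimes>\<^bsub>A\<^esub> c) + T b (c \<otimes>\<^bsub>A\<^esub> a))"

context banach_algebra
begin

abbreviation L :: "(('a \<Rightarrow> 'k) \<Rightarrow> 'k) \<Rightarrow> ('a \<Rightarrow> 'k) \<Rightarrow> 'k" where
  "L \<equiv> bidual_lim A"

abbreviation bd :: "(('a \<Rightarrow> 'k) \<Rightarrow> 'k) set" where
  "bd \<equiv> carrier (bidual A)"

section \<open>Derivations as bilinear forms\<close>

lemma form2_of_derivation:
  assumes D: "bounded_linear_map A (dual A) D" shows "form2 A D"
proof -
  have in_dual: "D a \<in> carrier (dual A)" if "a \<in> carrier A" for a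
    using D that by (auto simp: bounded_linear_map_def)
  obtain C where C: "\<And>a. a \<in> carrier A \<Longrightarrow> nrm (dual A) (D a) \<le> C * nrm A a"
    using D unfolding bounded_linear_map_def by blast
  have "norm (D a b) \<le> \<bar>C\<bar> * nrm A a * nrm A b" if ab: "a \<in> carrier A" "b \<in> carrier A" for a b
  proof -
    have "C * nrm A a \<le> \<bar>C\<bar> * nrm A a" using nrm_nonneg[OF ab(1)] by (intro mult_right_mono) auto
    then have "nrm (dual A) (D a) * nrm A b \<le> \<bar>C\<bar> * nrm A a * nrm A b"
      using C[OF ab(1)] nrm_nonneg[OF ab(2)] by (intro mult_right_mono) auto
    then show ?thesis using norm_dual_le[OF in_dual ab(2)] ab(1) by force
  qed
  moreover have "linear_form A (\<lambda>a. D a b)" if "b \<in> carrier A" for b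
    using D that unfolding bounded_linear_map_def linear_form_def by (simp add: dual_simps)
  ultimately show ?thesis
    unfolding form2_def by (intro conjI ballI exI[of _ "\<bar>C\<bar>"]) (auto intro: form1_linear form1_dual in_dual)
qed

lemma derivation_form_of_derivation:
  assumes "derivation A D" shows "derivation_form A D"
  unfolding derivation_form_def
proof (intro conjI ballI)
  show "form2 A D" using assms by (intro form2_of_derivation) (simp add: derivation_def)
  fix a b c assume "a \<in> carrier A" "b \<in> carrier A" "c \<in> carrier A"
  then show "D (a \<otimes> b) c = D a (b \<otimes> c) + D b (c \<otimes> a)"
    using assms by (simp add: derivation_def dual_simps dual_left_act_def dual_right_act_def)
qed

text \<open>Lets the topological centre hypothesis, which speaks of derivations, be applied to any
  form with the cyclic identity, in particular to inner ones. The restriction puts each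
  \<open>T a\<close> into the dual.\<close>

lemma derivation_of_derivation_form:
  assumes T: "derivation_form A T" shows "derivation A (\<lambda>a. restrict (T a) (carrier A))"
proof -
  have T2: "form2 A T" using T by (simp add: derivation_form_def)
  obtain C where C: "C \<ge> 0"
    "\<And>x y. \<lbrakk>x \<in> carrier A; y \<in> carrier A\<rbrakk> \<Longrightarrow> norm (T x y) \<le> C * nrm A x * nrm A y"
    using T2 unfolding form2_def by blast
  have "nrm (dual A) (restrict (T a) (carrier A)) \<le> C * nrm A a" if "a \<in> carrier A" for a
    using C that nrm_nonneg by (intro nrm_dual_le) auto
  moreover have "restrict (T a) (carrier A) \<in> carrier (dual A)" if "a \<in> carrier A" for a
    using form2_slot[OF T2 that] by (simp add: restrict_in_dual_iff)
  moreover have "restrict (T (a \<oplus> b)) (carrier A) = restrict (T a) (carrier A) \<oplus>\<^bsub>dual A\<^esub> restrict (T b) (carrier A)"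
    if "a \<in> carrier A" "b \<in> carrier A" for a b
    using that by (auto simp: dual_simps form1D(1)[OF form2_slot2[OF T2]])
  moreover have "restrict (T (c \<odot> a)) (carrier A) = c \<odot>\<^bsub>dual A\<^esub> restrict (T a) (carrier A)"
    if "a \<in> carrier A" for a c
    using that by (auto simp: dual_simps form1D(2)[OF form2_slot2[OF T2]])
  ultimately have "bounded_linear_map A (dual A) (\<lambda>a. restrict (T a) (carrier A))"
    unfolding bounded_linear_map_def by blast
  moreover have "restrict (T (a \<otimes> b)) (carrier A) =
      dual_right_act A (restrict (T a) (carrier A)) b \<oplus>\<^bsub>dual A\<^esub> dual_left_act A a (restrict (T b) (carrier A))"
    if "a \<in> carrier A" "b \<in> carrier A" for a b
    using that T by (auto simp: dual_simps dual_left_act_def dual_right_act_def derivation_form_def mult_closed)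
  ultimately show ?thesis by (simp add: derivation_def)
qed

text \<open>This is the form of the inner derivation given by \<open>g\<close>; in the cyclic
  identity the two occurrences of \<open>g\<close> at the word \<open>b c a\<close> cancel.\<close>

lemma inner_derivation_form:
  assumes g: "form1 A g" shows "derivation_form A (\<lambda>a b. g (b \<otimes> a) - g (a \<otimes> b))"
  unfolding derivation_form_def
proof (intro conjI ballI)
  show "form2 A (\<lambda>a b. g (b \<otimes> a) - g (a \<otimes> b))"
    by (intro form2_diff form2_mult[OF g] form2_flip[OF form2_mult[OF g]])
qed (simp add: mult_assoc mult_closed)

section \<open>The topological centre as an interchange of limits\<close>

lemma bidual_lim_linear_biadjoint:
  assumes "p \<in> bd"
  shows "linear_biadjoint A (dual A) (\<lambda>a. restrict (T a) (carrier A)) m p = L m (\<lambda>a. L p (T a))"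
  using assms by (simp add: linear_biadjoint_def linear_adjoint_def bidual_lim_def)

text \<open>The second adjoint of \<pi>* is the first Arens product. Membership of \<open>F\<close>
  in the left topological centre therefore makes \<open>F\<close>, evaluated at the product of
  \<open>n\<close> and \<open>p\<close>, weak* continuous in \<open>n\<close> for each fixed
  \<open>p\<close>.\<close>

lemma triadjoint_module_action:
  assumes "p \<in> bd"
  shows "bilinear_triadjoint (dual A) A (dual A) (bilinear_adjoint A (mult A)) F n p = F (n \<otimes>\<^bsub>arens A\<^esub> p)"
  using assms by (simp add: arens_mult_apply bilinear_triadjoint_def bilinear_adjoint_def bidual_lim_def)

lemma form2_right: "form2 A T \<Longrightarrow> form2 A (\<lambda>a b. T a (b \<otimes> k))" if "k \<in> carrier A"
  using form3_slot[OF form3_rotate[OF form3_mult_right] that] .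

lemma form2_left: "form2 A T \<Longrightarrow> form2 A (\<lambda>a b. T a (k \<otimes> b))" if "k \<in> carrier A"
  using form3_slot[OF form3_swap[OF form3_mult_right] that] .

text \<open>As a function of \<open>n\<close>, the left side is the second adjoint of the derivation
  at \<open>m\<close>, evaluated at the product of \<open>n\<close> and \<open>p\<close>. The centre
  hypothesis makes it weak* continuous, hence evaluation at some \<open>f\<close> in the dual. The
  values of \<open>f\<close> are found by taking for \<open>n\<close> the points of the algebra, and
  the limit of \<open>f\<close> along \<open>n\<close> is the right side.\<close>

lemma centre_interchange:
  assumes T: "derivation_form A T"
    and centre: "linear_biadjoint A (dual A) (\<lambda>a. restrict (T a) (carrier A)) ` bd
        \<subseteq> left_topological_centre (dual A) A (dual A) (bilinear_adjoint A (mult A))"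
    and m: "m \<in> bd" and n: "n \<in> bd" and p: "p \<in> bd"
  shows "L m (\<lambda>a. L n (\<lambda>b. L p (\<lambda>c. T a (b \<otimes> c)))) = L n (\<lambda>b. L m (\<lambda>a. L p (\<lambda>c. T a (b \<otimes> c))))"
proof -
  interpret d: normed_space "dual A" by (rule dual_normed)
  have T2: "form2 A T" using T by (simp add: derivation_form_def)
  have Tp: "form2 A (\<lambda>a b. L p (\<lambda>c. T a (b \<otimes> c)))" by (rule form3_lim[OF p form3_mult_right[OF T2]])
  define F where "F = linear_biadjoint A (dual A) (\<lambda>a. restrict (T a) (carrier A)) m"
  define G where "G n = L m (\<lambda>a. L n (\<lambda>b. L p (\<lambda>c. T a (b \<otimes> c))))" for n
  have F: "F (n \<otimes>\<^bsub>arens A\<^esub> p) = G n" if n: "n \<in> bd" for n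
  proof -
    have "F (n \<otimes>\<^bsub>arens A\<^esub> p) = L m (\<lambda>a. L (n \<otimes>\<^bsub>arens A\<^esub> p) (T a))"
      unfolding F_def by (rule bidual_lim_linear_biadjoint[OF arens_closed[OF n p]])
    also have "\<dots> = G n"
      unfolding G_def by (rule bidual_lim_cong) (rule bidual_lim_arens[OF form2_slot[OF T2]])
    finally show ?thesis .
  qed
  have lin: "linear_form (bidual A) G"
    unfolding G_def by (rule normed_space.form1_linear[OF d.dual_normed form1_bidual_lim_lim[OF Tp m]])
  have "continuous_map (weak_star (dual A)) (weak_star (bidual A))
      (bilinear_triadjoint (dual A) A (dual A) (bilinear_adjoint A (mult A)) F)"
    using centre m unfolding F_def left_topological_centre_def by blast
  moreover have "continuous_map (weak_star (bidual A)) euclidean (\<lambda>\<phi>. \<phi> p)"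
    unfolding weak_star_def using p by (intro continuous_map_from_subtopology continuous_map_product_projection)
  ultimately have "continuous_map (weak_star (dual A)) euclidean
      ((\<lambda>\<phi>. \<phi> p) \<circ> bilinear_triadjoint (dual A) A (dual A) (bilinear_adjoint A (mult A)) F)"
    by (rule continuous_map_compose)
  then have "continuous_map (weak_star (dual A)) euclidean G"
  proof (rule continuous_map_eq)
    fix n assume "n \<in> topspace (weak_star (dual A))"
    then have "n \<in> bd" by (simp add: weak_star_def)
    then show "((\<lambda>\<phi>. \<phi> p) \<circ> bilinear_triadjoint (dual A) A (dual A) (bilinear_adjoint A (mult A)) F) n = G n"
      by (simp add: triadjoint_module_action p F)
  qed
  then obtain f where f: "f \<in> carrier (dual A)" "\<And>n. n \<in> bd \<Longrightarrow> G n = n f"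
    using d.weak_star_continuous_functional[OF lin] by blast
  have fb: "f b = L m (\<lambda>a. L p (\<lambda>c. T a (b \<otimes> c)))" if b: "b \<in> carrier A" for b
  proof -
    have "f b = L (bidual_embed A b) f" using bidual_lim_embed[OF b form1_dual[OF f(1)]] by simp
    also have "\<dots> = G (bidual_embed A b)"
      using f b by (simp add: bidual_lim_dual bidual_embed_in_carrier)
    also have "\<dots> = L m (\<lambda>a. L p (\<lambda>c. T a (b \<otimes> c)))"
      unfolding G_def by (rule bidual_lim_cong) (rule bidual_lim_embed[OF b form2_slot[OF Tp]])
    finally show ?thesis .
  qed
  have "G n = L n f" using f n by (simp add: bidual_lim_dual)
  also have "\<dots> = L n (\<lambda>b. L m (\<lambda>a. L p (\<lambda>c. T a (b \<otimes> c))))" by (rule bidual_lim_cong) (rule fb)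
  finally show ?thesis by (simp add: G_def)
qed

section \<open>Weak amenability of the second dual\<close>

lemma form1_arens:
  assumes \<Phi>: "form1 (bidual A) \<Phi>" and m: "m \<in> bd"
  shows "form1 (bidual A) (\<lambda>n. \<Phi> (m \<otimes>\<^bsub>arens A\<^esub> n))" "form1 (bidual A) (\<lambda>n. \<Phi> (n \<otimes>\<^bsub>arens A\<^esub> m))"
proof -
  interpret b: normed_space "bidual A" by (rule normed_space.dual_normed[OF dual_normed])
  obtain C where C: "C \<ge> 0" "\<And>n. n \<in> bd \<Longrightarrow> norm (\<Phi> n) \<le> C * nrm (bidual A) n"
    using \<Phi> by (auto simp: form1_def)
  have nm: "0 \<le> nrm (bidual A) n" if "n \<in> bd" for n using b.nrm_nonneg[OF that] .
  \<comment> \<open>Bilinearity of the Arens product is tested on forms, where it reduces to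
    linearity of the limits.\<close>
  have add1: "m \<otimes>\<^bsub>arens A\<^esub> (n \<oplus>\<^bsub>bidual A\<^esub> q) = (m \<otimes>\<^bsub>arens A\<^esub> n) \<oplus>\<^bsub>bidual A\<^esub> (m \<otimes>\<^bsub>arens A\<^esub> q)"
    and add2: "(n \<oplus>\<^bsub>bidual A\<^esub> q) \<otimes>\<^bsub>arens A\<^esub> m = (n \<otimes>\<^bsub>arens A\<^esub> m) \<oplus>\<^bsub>bidual A\<^esub> (q \<otimes>\<^bsub>arens A\<^esub> m)"
    if nq: "n \<in> bd" "q \<in> bd" for n q
  proof -
    have F: "form2 A (\<lambda>x y. f (x \<otimes> y))" if "form1 A f" for f by (rule form2_mult[OF that])
    have l1: "L (m \<otimes>\<^bsub>arens A\<^esub> (n \<oplus>\<^bsub>bidual A\<^esub> q)) f = L (m \<otimes>\<^bsub>arens A\<^esub> n) f + L (m \<otimes>\<^bsub>arens A\<^esub> q) f"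
      if f: "form1 A f" for f
    proof -
      have "L m (\<lambda>x. L (n \<oplus>\<^bsub>bidual A\<^esub> q) (\<lambda>y. f (x \<otimes> y))) =
          L m (\<lambda>x. L n (\<lambda>y. f (x \<otimes> y)) + L q (\<lambda>y. f (x \<otimes> y)))"
        by (intro bidual_lim_cong bidual_lim_bidual_add nq form2_slot[OF F[OF f]])
      then show ?thesis
        by (simp only: bidual_lim_arens[OF f] bidual_lim_add[OF m form2_lim[OF nq(1) F[OF f]] form2_lim[OF nq(2) F[OF f]]])
    qed
    have l2: "L ((n \<oplus>\<^bsub>bidual A\<^esub> q) \<otimes>\<^bsub>arens A\<^esub> m) f = L (n \<otimes>\<^bsub>arens A\<^esub> m) f + L (q \<otimes>\<^bsub>arens A\<^esub> m) f"
      if f: "form1 A f" for f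
      by (simp only: bidual_lim_arens[OF f] bidual_lim_bidual_add[OF nq form2_lim[OF m F[OF f]]])
    show "m \<otimes>\<^bsub>arens A\<^esub> (n \<oplus>\<^bsub>bidual A\<^esub> q) = (m \<otimes>\<^bsub>arens A\<^esub> n) \<oplus>\<^bsub>bidual A\<^esub> (m \<otimes>\<^bsub>arens A\<^esub> q)"
      by (rule bidual_eqI) (simp_all only: l1 bidual_lim_bidual_add arens_closed m nq b.a_closed)
    show "(n \<oplus>\<^bsub>bidual A\<^esub> q) \<otimes>\<^bsub>arens A\<^esub> m = (n \<otimes>\<^bsub>arens A\<^esub> m) \<oplus>\<^bsub>bidual A\<^esub> (q \<otimes>\<^bsub>arens A\<^esub> m)"
      by (rule bidual_eqI) (simp_all only: l2 bidual_lim_bidual_add arens_closed m nq b.a_closed)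
  qed
  have sm1: "m \<otimes>\<^bsub>arens A\<^esub> (c \<odot>\<^bsub>bidual A\<^esub> n) = c \<odot>\<^bsub>bidual A\<^esub> (m \<otimes>\<^bsub>arens A\<^esub> n)"
    and sm2: "(c \<odot>\<^bsub>bidual A\<^esub> n) \<otimes>\<^bsub>arens A\<^esub> m = c \<odot>\<^bsub>bidual A\<^esub> (n \<otimes>\<^bsub>arens A\<^esub> m)"
    if n: "n \<in> bd" for n c
  proof -
    have F: "form2 A (\<lambda>x y. f (x \<otimes> y))" if "form1 A f" for f by (rule form2_mult[OF that])
    have l1: "L (m \<otimes>\<^bsub>arens A\<^esub> (c \<odot>\<^bsub>bidual A\<^esub> n)) f = c * L (m \<otimes>\<^bsub>arens A\<^esub> n) f" if f: "form1 A f" for f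
    proof -
      have "L m (\<lambda>x. L (c \<odot>\<^bsub>bidual A\<^esub> n) (\<lambda>y. f (x \<otimes> y))) = L m (\<lambda>x. c * L n (\<lambda>y. f (x \<otimes> y)))"
        by (intro bidual_lim_cong bidual_lim_bidual_smult n form2_slot[OF F[OF f]])
      then show ?thesis
        by (simp only: bidual_lim_arens[OF f] bidual_lim_cmult[OF m form2_lim[OF n F[OF f]]])
    qed
    have l2: "L ((c \<odot>\<^bsub>bidual A\<^esub> n) \<otimes>\<^bsub>arens A\<^esub> m) f = c * L (n \<otimes>\<^bsub>arens A\<^esub> m) f" if f: "form1 A f" for f
      by (simp only: bidual_lim_arens[OF f] bidual_lim_bidual_smult[OF n form2_lim[OF m F[OF f]]])
    show "m \<otimes>\<^bsub>arens A\<^esub> (c \<odot>\<^bsub>bidual A\<^esub> n) = c \<odot>\<^bsub>bidual A\<^esub> (m \<otimes>\<^bsub>arens A\<^esub> n)"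
      by (rule bidual_eqI) (simp_all only: l1 bidual_lim_bidual_smult arens_closed m n b.smult_in_carrier)
    show "(c \<odot>\<^bsub>bidual A\<^esub> n) \<otimes>\<^bsub>arens A\<^esub> m = c \<odot>\<^bsub>bidual A\<^esub> (n \<otimes>\<^bsub>arens A\<^esub> m)"
      by (rule bidual_eqI) (simp_all only: l2 bidual_lim_bidual_smult arens_closed m n b.smult_in_carrier)
  qed
  have bound1: "norm (\<Phi> (m \<otimes>\<^bsub>arens A\<^esub> n)) \<le> (C * nrm (bidual A) m) * nrm (bidual A) n"
    and bound2: "norm (\<Phi> (n \<otimes>\<^bsub>arens A\<^esub> m)) \<le> (C * nrm (bidual A) m) * nrm (bidual A) n" if n: "n \<in> bd" for n
    using C(2)[OF arens_closed[OF m n]] mult_left_mono[OF nrm_arens_le[OF m n] C(1)]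
      C(2)[OF arens_closed[OF n m]] mult_left_mono[OF nrm_arens_le[OF n m] C(1)] by (simp_all add: mult_ac)
  have C': "0 \<le> C * nrm (bidual A) m" using C(1) nm[OF m] by simp
  show "form1 (bidual A) (\<lambda>n. \<Phi> (m \<otimes>\<^bsub>arens A\<^esub> n))"
    by (rule form1_bidual[OF _ _ C' bound1])
       (simp_all only: add1 sm1 b.form1D[OF \<Phi>] arens_closed m)
  show "form1 (bidual A) (\<lambda>n. \<Phi> (n \<otimes>\<^bsub>arens A\<^esub> m))"
    by (rule form1_bidual[OF _ _ C' bound2])
       (simp_all only: add2 sm2 b.form1D[OF \<Phi>] arens_closed m)
qed

lemma weakly_amenable_arens_inner:
  assumes wa: "weakly_amenable (arens A)"
    and D: "derivation (arens A) D"
  obtains \<Psi> where "form1 (bidual A) \<Psi>"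
    "\<And>m n. \<lbrakk>m \<in> bd; n \<in> bd\<rbrakk> \<Longrightarrow> D m n = \<Psi> (n \<otimes>\<^bsub>arens A\<^esub> m) - \<Psi> (m \<otimes>\<^bsub>arens A\<^esub> n)"
proof -
  interpret b: normed_space "bidual A" by (rule normed_space.dual_normed[OF dual_normed])
  obtain \<Psi> where \<Psi>: "\<Psi> \<in> carrier (dual (bidual A))" "\<And>m. m \<in> bd \<Longrightarrow>
      D m = dual_left_act (arens A) m \<Psi> \<ominus>\<^bsub>dual (bidual A)\<^esub> dual_right_act (arens A) \<Psi> m"
    using wa D unfolding weakly_amenable_def inner_derivation_def arens_simps by blast
  have f: "form1 (bidual A) \<Psi>" by (rule b.form1_dual[OF \<Psi>(1)])
  show ?thesis
  proof (rule that[OF f])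
    fix m n assume mn: "m \<in> bd" "n \<in> bd"
    \<comment> \<open>The difference can be evaluated pointwise once both actions are known to lie
      in the dual of the bidual; this is where \<open>form1_arens\<close> enters.\<close>
    have "dual_left_act (arens A) m \<Psi> \<in> carrier (dual (bidual A))"
      "dual_right_act (arens A) \<Psi> m \<in> carrier (dual (bidual A))"
      unfolding dual_left_act_def dual_right_act_def arens_simps b.restrict_in_dual_iff
      by (rule form1_arens[OF f mn(1)])+
    from b.dual_minus_apply[OF this] show "D m n = \<Psi> (n \<otimes>\<^bsub>arens A\<^esub> m) - \<Psi> (m \<otimes>\<^bsub>arens A\<^esub> n)"
      using \<Psi>(2)[OF mn(1)] mn by (simp add: dual_left_act_def dual_right_act_def arens_simps)
  qed
qed

text \<open>The rank-one map sending \<open>m\<close> to \<open>\<Phi> m \<cdot> \<Phi>\<close> is a derivation, and inner derivations vanish on the diagonal.\<close>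

lemma arens_dense:
  assumes wa: "weakly_amenable (arens A)"
    and \<Phi>: "form1 (bidual A) \<Phi>"
    and zero: "\<And>m n. \<lbrakk>m \<in> bd; n \<in> bd\<rbrakk> \<Longrightarrow> \<Phi> (m \<otimes>\<^bsub>arens A\<^esub> n) = 0"
    and m: "m \<in> bd"
  shows "\<Phi> m = 0"
proof -
  interpret b: normed_space "bidual A" by (rule normed_space.dual_normed[OF dual_normed])
  define D where "D m = (\<lambda>n\<in>bd. \<Phi> m * \<Phi> n)" for m
  obtain C where C: "C \<ge> 0" "\<And>n. n \<in> bd \<Longrightarrow> norm (\<Phi> n) \<le> C * nrm (bidual A) n"
    using \<Phi> by (auto simp: form1_def)
  have bnd: "nrm (dual (bidual A)) (D m) \<le> (C * C) * nrm (bidual A) m" if m: "m \<in> bd" for m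
    unfolding D_def
  proof (rule b.nrm_dual_le)
    show "0 \<le> C * C * nrm (bidual A) m" using C(1) b.nrm_nonneg[OF m] by simp
    fix n assume n: "n \<in> bd"
    have "norm (\<Phi> m) * norm (\<Phi> n) \<le> (C * nrm (bidual A) m) * (C * nrm (bidual A) n)"
      using C b.nrm_nonneg m n by (intro mult_mono) auto
    then show "norm (\<Phi> m * \<Phi> n) \<le> C * C * nrm (bidual A) m * nrm (bidual A) n"
      by (simp add: norm_mult mult_ac)
  qed
  have "bounded_linear_map (arens A) (dual (arens A)) D"
    unfolding bounded_linear_map_def arens_simps
  proof (intro conjI ballI allI)
    show "D \<in> bd \<rightarrow> carrier (dual (bidual A))"
      by (auto simp: D_def b.restrict_in_dual_iff intro!: b.form1_cmult[OF \<Phi>])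
    show "\<exists>C. \<forall>x\<in>bd. nrm (dual (bidual A)) (D x) \<le> C * nrm (bidual A) x" using bnd by blast
    fix m assume m: "m \<in> bd"
    show "D (c \<odot>\<^bsub>bidual A\<^esub> m) = c \<odot>\<^bsub>dual (bidual A)\<^esub> D m" for c
      using m by (simp add: D_def b.form1D[OF \<Phi>] dual_simps(2)[where X = "bidual A"] mult.assoc cong: restrict_cong)
    fix n assume n: "n \<in> bd"
    show "D (m \<oplus>\<^bsub>bidual A\<^esub> n) = D m \<oplus>\<^bsub>dual (bidual A)\<^esub> D n"
      using m n by (simp add: D_def b.form1D[OF \<Phi>] dual_simps(1)[where X = "bidual A"] distrib_right cong: restrict_cong)
  qed
  \<comment> \<open>Both sides are zero, since each term contains \<open>\<Phi>\<close> of a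
    product.\<close>
  moreover have "D (m \<otimes>\<^bsub>arens A\<^esub> n) =
      dual_right_act (arens A) (D m) n \<oplus>\<^bsub>dual (arens A)\<^esub> dual_left_act (arens A) m (D n)"
    if "m \<in> bd" "n \<in> bd" for m n
    using that by (simp add: D_def zero dual_right_act_def dual_left_act_def arens_simps
      dual_simps(1)[where X = "bidual A"] arens_closed cong: restrict_cong)
  ultimately have "derivation (arens A) D" by (simp add: derivation_def arens_simps)
  then obtain \<Psi> where "\<And>m n. \<lbrakk>m \<in> bd; n \<in> bd\<rbrakk> \<Longrightarrow> D m n = \<Psi> (n \<otimes>\<^bsub>arens A\<^esub> m) - \<Psi> (m \<otimes>\<^bsub>arens A\<^esub> n)"
    using weakly_amenable_arens_inner[OF wa] by blast
  from this[OF m m] show ?thesis using m by (simp add: D_def)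
qed

section \<open>Interchange of iterated limits\<close>

text \<open>A fixed factor from the algebra is absorbed into the bidual element. With
  \<open>bidual_lim_arens_embed\<close> this extends an interchange valid for all bidual elements to
  words with additional fixed factors.\<close>

lemma bidual_lim_embed_arens:
  assumes "a \<in> carrier A" "n \<in> bd" "form1 A h"
  shows "L (bidual_embed A a \<otimes>\<^bsub>arens A\<^esub> n) h = L n (\<lambda>b. h (a \<otimes> b))"
  using bidual_lim_embed[OF assms(1) form2_lim[OF assms(2) form2_mult[OF assms(3)]]]
  by (simp add: bidual_lim_arens assms)

lemma bidual_lim_arens_embed:
  assumes "b \<in> carrier A" "form1 A h"
  shows "L (m \<otimes>\<^bsub>arens A\<^esub> bidual_embed A b) h = L m (\<lambda>a. h (a \<otimes> b))"
  unfolding bidual_lim_arens[OF assms(2)]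
  by (rule bidual_lim_cong) (rule bidual_lim_embed[OF assms(1) form2_slot[OF form2_mult[OF assms(2)]]])

lemma iterated_lim_diff:
  assumes F: "form3 A F" and G: "form3 A G"
    and H: "\<And>x y z. \<lbrakk>x \<in> carrier A; y \<in> carrier A; z \<in> carrier A\<rbrakk> \<Longrightarrow> H x y z = F x y z - G x y z"
    and lmn: "l \<in> bd" "m \<in> bd" "n \<in> bd"
  shows "L l (\<lambda>x. L m (\<lambda>y. L n (\<lambda>z. H x y z))) =
    L l (\<lambda>x. L m (\<lambda>y. L n (\<lambda>z. F x y z))) - L l (\<lambda>x. L m (\<lambda>y. L n (\<lambda>z. G x y z)))"
proof -
  have "L l (\<lambda>x. L m (\<lambda>y. L n (\<lambda>z. H x y z))) =
      L l (\<lambda>x. L m (\<lambda>y. L n (\<lambda>z. F x y z - G x y z)))"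
    by (intro bidual_lim_cong H)
  also have "\<dots> = L l (\<lambda>x. L m (\<lambda>y. L n (\<lambda>z. F x y z) - L n (\<lambda>z. G x y z)))"
    by (intro bidual_lim_cong bidual_lim_diff lmn form2_slot[OF form3_slot[OF F]] form2_slot[OF form3_slot[OF G]])
  also have "\<dots> = L l (\<lambda>x. L m (\<lambda>y. L n (\<lambda>z. F x y z)) - L m (\<lambda>y. L n (\<lambda>z. G x y z)))"
    by (intro bidual_lim_cong bidual_lim_diff lmn
        form2_lim[OF lmn(3) form3_slot[OF F]] form2_lim[OF lmn(3) form3_slot[OF G]])
  also have "\<dots> = L l (\<lambda>x. L m (\<lambda>y. L n (\<lambda>z. F x y z))) - L l (\<lambda>x. L m (\<lambda>y. L n (\<lambda>z. G x y z)))"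
    by (intro bidual_lim_diff lmn form2_lim[OF lmn(2) form3_lim[OF lmn(3) F]]
        form2_lim[OF lmn(2) form3_lim[OF lmn(3) G]])
  finally show ?thesis .
qed

text \<open>The conclusion of \<open>centre_interchange\<close>. Only the two outer limits move; the
  limit over \<open>c\<close> stays innermost on both sides.\<close>

definition interchange :: "('a \<Rightarrow> 'a \<Rightarrow> 'k) \<Rightarrow> bool" where
  "interchange T \<longleftrightarrow> (\<forall>m\<in>bd. \<forall>n\<in>bd. \<forall>p\<in>bd.
     L m (\<lambda>a. L n (\<lambda>b. L p (\<lambda>c. T a (b \<otimes> c)))) = L n (\<lambda>b. L m (\<lambda>a. L p (\<lambda>c. T a (b \<otimes> c)))))"

text \<open>Take for \<open>p\<close> the image of \<open>k\<close> in the bidual: the innermost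
  limit becomes an evaluation, and a plain exchange of two limits remains.\<close>

lemma interchange_const:
  assumes T: "form2 A T" and I: "interchange T" and m: "m \<in> bd" and n: "n \<in> bd" and k: "k \<in> carrier A"
  shows "L m (\<lambda>a. L n (\<lambda>b. T a (b \<otimes> k))) = L n (\<lambda>b. L m (\<lambda>a. T a (b \<otimes> k)))"
proof -
  have e: "L (bidual_embed A k) (\<lambda>c. T a (b \<otimes> c)) = T a (b \<otimes> k)" if "a \<in> carrier A" "b \<in> carrier A" for a b
    by (rule bidual_lim_embed[OF k form2_slot[OF form3_slot[OF form3_mult_right[OF T] that(1)] that(2)]])
  have "L m (\<lambda>a. L n (\<lambda>b. T a (b \<otimes> k))) = L m (\<lambda>a. L n (\<lambda>b. L (bidual_embed A k) (\<lambda>c. T a (b \<otimes> c))))"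
    by (intro bidual_lim_cong) (simp add: e)
  also have "\<dots> = L n (\<lambda>b. L m (\<lambda>a. L (bidual_embed A k) (\<lambda>c. T a (b \<otimes> c))))"
    using I m n bidual_embed_in_carrier[OF k] unfolding interchange_def by blast
  also have "\<dots> = L n (\<lambda>b. L m (\<lambda>a. T a (b \<otimes> k)))"
    by (intro bidual_lim_cong) (simp add: e)
  finally show ?thesis .
qed

text \<open>Regrouping the word as \<open>(k \<otimes> b) \<otimes> c\<close> lets \<open>n\<close>
  absorb \<open>k\<close>.\<close>

lemma interchange_left:
  assumes T: "form2 A T" and I: "interchange T" and mnp: "m \<in> bd" "n \<in> bd" "p \<in> bd" and k: "k \<in> carrier A"
  shows "L m (\<lambda>a. L n (\<lambda>b. L p (\<lambda>c. T a (k \<otimes> (b \<otimes> c))))) = L n (\<lambda>b. L m (\<lambda>a. L p (\<lambda>c. T a (k \<otimes> (b \<otimes> c)))))"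
proof -
  let ?n = "bidual_embed A k \<otimes>\<^bsub>arens A\<^esub> n"
  have n': "?n \<in> bd" using bidual_embed_in_carrier[OF k] mnp by (simp add: arens_closed)
  have F: "form2 A (\<lambda>a b. L p (\<lambda>c. T a (b \<otimes> c)))" by (rule form3_lim[OF mnp(3) form3_mult_right[OF T]])
  have "L m (\<lambda>a. L n (\<lambda>b. L p (\<lambda>c. T a (k \<otimes> (b \<otimes> c))))) = L m (\<lambda>a. L n (\<lambda>b. L p (\<lambda>c. T a ((k \<otimes> b) \<otimes> c))))"
    by (intro bidual_lim_cong) (simp add: mult_assoc k)
  also have "\<dots> = L m (\<lambda>a. L ?n (\<lambda>b. L p (\<lambda>c. T a (b \<otimes> c))))"
    by (intro bidual_lim_cong bidual_lim_embed_arens[symmetric] k mnp form2_slot[OF F])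
  also have "\<dots> = L ?n (\<lambda>b. L m (\<lambda>a. L p (\<lambda>c. T a (b \<otimes> c))))"
    using I mnp n' unfolding interchange_def by blast
  also have "\<dots> = L n (\<lambda>b. L m (\<lambda>a. L p (\<lambda>c. T a ((k \<otimes> b) \<otimes> c))))"
    by (intro bidual_lim_embed_arens k mnp form2_lim[OF mnp(1) form2_flip[OF F]])
  also have "\<dots> = L n (\<lambda>b. L m (\<lambda>a. L p (\<lambda>c. T a (k \<otimes> (b \<otimes> c)))))"
    by (intro bidual_lim_cong) (simp add: mult_assoc k)
  finally show ?thesis .
qed

text \<open>Regrouping the word as \<open>b \<otimes> (c \<otimes> k)\<close> lets \<open>p\<close>
  absorb \<open>k\<close>.\<close>

lemma interchange_right:
  assumes T: "form2 A T" and I: "interchange T" and mnp: "m \<in> bd" "n \<in> bd" "p \<in> bd" and k: "k \<in> carrier A"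
  shows "L m (\<lambda>a. L n (\<lambda>b. L p (\<lambda>c. T a ((b \<otimes> c) \<otimes> k)))) = L n (\<lambda>b. L m (\<lambda>a. L p (\<lambda>c. T a ((b \<otimes> c) \<otimes> k))))"
proof -
  let ?p = "p \<otimes>\<^bsub>arens A\<^esub> bidual_embed A k"
  have p': "?p \<in> bd" using bidual_embed_in_carrier[OF k] mnp by (simp add: arens_closed)
  have e: "L p (\<lambda>c. T a ((b \<otimes> c) \<otimes> k)) = L ?p (\<lambda>c. T a (b \<otimes> c))" if "a \<in> carrier A" "b \<in> carrier A" for a b
  proof -
    have "L p (\<lambda>c. T a ((b \<otimes> c) \<otimes> k)) = L p (\<lambda>c. T a (b \<otimes> (c \<otimes> k)))"
      by (rule bidual_lim_cong) (simp add: mult_assoc k that)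
    then show ?thesis
      using bidual_lim_arens_embed[OF k form2_slot[OF form3_slot[OF form3_mult_right[OF T] that(1)] that(2)]]
      by simp
  qed
  have "L m (\<lambda>a. L n (\<lambda>b. L p (\<lambda>c. T a ((b \<otimes> c) \<otimes> k)))) = L m (\<lambda>a. L n (\<lambda>b. L ?p (\<lambda>c. T a (b \<otimes> c))))"
    by (intro bidual_lim_cong e)
  also have "\<dots> = L n (\<lambda>b. L m (\<lambda>a. L ?p (\<lambda>c. T a (b \<otimes> c))))"
    using I mnp p' unfolding interchange_def by blast
  also have "\<dots> = L n (\<lambda>b. L m (\<lambda>a. L p (\<lambda>c. T a ((b \<otimes> c) \<otimes> k))))"
    by (intro bidual_lim_cong e[symmetric])
  finally show ?thesis .
qed

text \<open>The two orders are compared through the intermediate order \<open>a, c, b\<close>. The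
  cyclic identity reduces the form to words whose exchanges are available; the functional
  \<open>T _ k\<close> supplies an inner derivation, and its interchange links the words
  \<open>a b c\<close> and \<open>c a b\<close>.\<close>

lemma interchange_product:
  assumes T: "derivation_form A T" and I: "\<And>S. derivation_form A S \<Longrightarrow> interchange S"
    and x: "x \<in> bd" and y: "y \<in> bd" and v: "v \<in> bd" and k: "k \<in> carrier A"
  shows "L x (\<lambda>a. L y (\<lambda>b. L v (\<lambda>c. T (a \<otimes> b) (k \<otimes> c)))) =
    L v (\<lambda>c. L x (\<lambda>a. L y (\<lambda>b. T (a \<otimes> b) (k \<otimes> c))))"
proof -
  have T2: "form2 A T" and der: "\<And>a b c. \<lbrakk>a \<in> carrier A; b \<in> carrier A; c \<in> carrier A\<rbrakk> \<Longrightarrow>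
      T (a \<otimes> b) c = T a (b \<otimes> c) + T b (c \<otimes> a)"
    using T by (auto simp: derivation_form_def)
  have IT: "interchange T" by (rule I[OF T])
  note [simp] = mult_closed k
  let ?g = "\<lambda>z. T z k"
  have g: "form1 A ?g" by (rule form2_slot2[OF T2 k])
  let ?M = "\<lambda>a b c. T ((a \<otimes> b) \<otimes> c) k" and ?N = "\<lambda>a b c. T (c \<otimes> (a \<otimes> b)) k"
    and ?J = "\<lambda>a b c. T ((a \<otimes> b) \<otimes> c) k - T (c \<otimes> (a \<otimes> b)) k"
    and ?P = "\<lambda>a b c. T (a \<otimes> b) (c \<otimes> k)" and ?Q = "\<lambda>a b c. T c (k \<otimes> (a \<otimes> b))"
    and ?R = "\<lambda>a b c. T c ((a \<otimes> b) \<otimes> k)" and ?S = "\<lambda>a b c. T (a \<otimes> b) (k \<otimes> c)"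
    and ?U = "\<lambda>a b c. T (c \<otimes> a) (b \<otimes> k)" and ?W = "\<lambda>a b c. T b (k \<otimes> (c \<otimes> a))"
  have M: "form3 A ?M" by (rule form3_mult_left[OF form2_mult[OF g]])
  have N: "form3 A ?N" by (rule form3_rotate[OF form3_rotate[OF form3_mult_right[OF form2_mult[OF g]]]])
  have Q: "form3 A ?Q" by (rule form3_rotate[OF form3_rotate[OF form3_mult_right[OF form2_left[OF k T2]]]])
  have R: "form3 A ?R" by (rule form3_rotate[OF form3_rotate[OF form3_mult_right[OF form2_right[OF k T2]]]])
  have W: "form3 A ?W" by (rule form3_rotate[OF form3_mult_right[OF form2_left[OF k T2]]])
  \<comment> \<open>Three instances of the cyclic identity: \<open>?M = ?P + ?Q\<close>, and two
    splittings of one word, \<open>?N = ?R + ?S\<close> and \<open>?N = ?U + ?W\<close>.\<close>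
  have idP: "?P a b c = ?M a b c - ?Q a b c" and idS: "?S a b c = ?N a b c - ?R a b c"
    and idU: "?U a b c = ?N a b c - ?W a b c"
    if "a \<in> carrier A" "b \<in> carrier A" "c \<in> carrier A" for a b c
    using der[of "a \<otimes> b" c k] der[of c "a \<otimes> b" k] der[of "c \<otimes> a" b k] that
    by (simp_all add: mult_assoc[of c a b] algebra_simps)
  \<comment> \<open>The names list the bidual elements from the outermost limit to the innermost;
    the variables \<open>a\<close>, \<open>b\<close>, \<open>c\<close> always follow
    \<open>x\<close>, \<open>y\<close>, \<open>v\<close>.\<close>
  define xyv xvy vxy where
    "xyv F = L x (\<lambda>a. L y (\<lambda>b. L v (\<lambda>c. F a b c)))"
    and "xvy F = L x (\<lambda>a. L v (\<lambda>c. L y (\<lambda>b. F a b c)))"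
    and "vxy F = L v (\<lambda>c. L x (\<lambda>a. L y (\<lambda>b. F a b c)))" for F :: "'a \<Rightarrow> 'a \<Rightarrow> 'a \<Rightarrow> 'k"
  have diff: "xyv H = xyv F - xyv G" "xvy H = xvy F - xvy G" "vxy H = vxy F - vxy G"
    if "form3 A F" "form3 A G"
      "\<And>a b c. \<lbrakk>a \<in> carrier A; b \<in> carrier A; c \<in> carrier A\<rbrakk> \<Longrightarrow> H a b c = F a b c - G a b c" for F G H
    unfolding xyv_def xvy_def vxy_def
    by (rule iterated_lim_diff[OF that(1,2) _ x y v]
        iterated_lim_diff[OF form3_swap[OF form3_rotate[OF that(1)]] form3_swap[OF form3_rotate[OF that(2)]] _ x v y]
        iterated_lim_diff[OF form3_rotate[OF that(1)] form3_rotate[OF that(2)] _ v x y],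
        rule that(3); assumption)+
  note in_bd = bidual_embed_in_carrier arens_closed x y v
  \<comment> \<open>The second argument of \<open>?P\<close> ends in the fixed \<open>k\<close>, so
    after merging \<open>a\<close> and \<open>b\<close> into one variable
    \<open>interchange_const\<close> applies.\<close>
  have P_vxy: "vxy ?P = xyv ?P"
  proof -
    have "vxy ?P = L v (\<lambda>c. L (x \<otimes>\<^bsub>arens A\<^esub> y) (\<lambda>z. T z (c \<otimes> k)))"
      unfolding vxy_def by (intro bidual_lim_cong bidual_lim_arens[symmetric] form2_slot2[OF T2]) simp
    also have "\<dots> = L (x \<otimes>\<^bsub>arens A\<^esub> y) (\<lambda>z. L v (\<lambda>c. T z (c \<otimes> k)))"
      by (intro interchange_const[symmetric] T2 IT in_bd k)
    also have "\<dots> = xyv ?P"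
      unfolding xyv_def by (intro bidual_lim_arens form2_lim[OF v form2_right[OF k T2]])
    finally show ?thesis .
  qed
  have P_xvy: "xyv ?P = xvy ?P"
    unfolding xyv_def xvy_def
  proof (rule bidual_lim_cong)
    fix a assume a: "a \<in> carrier A"
    let ?y = "bidual_embed A a \<otimes>\<^bsub>arens A\<^esub> y"
    have "L y (\<lambda>b. L v (\<lambda>c. ?P a b c)) = L ?y (\<lambda>z. L v (\<lambda>c. T z (c \<otimes> k)))"
      by (intro bidual_lim_embed_arens[symmetric] a y form2_lim[OF v form2_right[OF k T2]])
    also have "\<dots> = L v (\<lambda>c. L ?y (\<lambda>z. T z (c \<otimes> k)))"
      by (intro interchange_const T2 IT in_bd a k)
    also have "\<dots> = L v (\<lambda>c. L y (\<lambda>b. ?P a b c))"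
      by (intro bidual_lim_cong bidual_lim_embed_arens a y form2_slot2[OF T2]) simp
    finally show "L y (\<lambda>b. L v (\<lambda>c. ?P a b c)) = L v (\<lambda>c. L y (\<lambda>b. ?P a b c))" .
  qed
  have Q_vxy: "vxy ?Q = xvy ?Q"
    unfolding vxy_def xvy_def by (rule interchange_left[OF T2 IT v x y k])
  have R_vxy: "vxy ?R = xvy ?R"
    unfolding vxy_def xvy_def by (rule interchange_right[OF T2 IT v x y k])
  have R_xvy: "xyv ?R = xvy ?R"
    unfolding xyv_def xvy_def
  proof (rule bidual_lim_cong)
    fix a assume a: "a \<in> carrier A"
    let ?y = "bidual_embed A a \<otimes>\<^bsub>arens A\<^esub> y"
    have "L y (\<lambda>b. L v (\<lambda>c. ?R a b c)) = L ?y (\<lambda>z. L v (\<lambda>c. T c (z \<otimes> k)))"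
      by (intro bidual_lim_embed_arens[symmetric] a y form2_lim[OF v form2_flip[OF form2_right[OF k T2]]])
    also have "\<dots> = L v (\<lambda>c. L ?y (\<lambda>z. T c (z \<otimes> k)))"
      by (intro interchange_const[symmetric] T2 IT in_bd a k)
    also have "\<dots> = L v (\<lambda>c. L y (\<lambda>b. ?R a b c))"
      by (intro bidual_lim_cong bidual_lim_embed_arens a y form2_slot[OF form2_right[OF k T2]])
    finally show "L y (\<lambda>b. L v (\<lambda>c. ?R a b c)) = L v (\<lambda>c. L y (\<lambda>b. ?R a b c))" .
  qed
  \<comment> \<open>With \<open>a\<close> fixed, \<open>v\<close> absorbs it, and an exchange of two
    limits with constant right factor \<open>k\<close> remains.\<close>
  have U_xvy: "xyv ?U = xvy ?U"
    unfolding xyv_def xvy_def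
  proof (rule bidual_lim_cong)
    fix a assume a: "a \<in> carrier A"
    let ?v = "v \<otimes>\<^bsub>arens A\<^esub> bidual_embed A a"
    have "L y (\<lambda>b. L v (\<lambda>c. ?U a b c)) = L y (\<lambda>b. L ?v (\<lambda>z. T z (b \<otimes> k)))"
      by (intro bidual_lim_cong bidual_lim_arens_embed[symmetric] a form2_slot2[OF T2]) simp
    also have "\<dots> = L ?v (\<lambda>z. L y (\<lambda>b. T z (b \<otimes> k)))"
      by (intro interchange_const[symmetric] T2 IT in_bd a k)
    also have "\<dots> = L v (\<lambda>c. L y (\<lambda>b. ?U a b c))"
      by (intro bidual_lim_arens_embed a form2_lim[OF y form2_right[OF k T2]])
    finally show "L y (\<lambda>b. L v (\<lambda>c. ?U a b c)) = L v (\<lambda>c. L y (\<lambda>b. ?U a b c))" .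
  qed
  \<comment> \<open>With \<open>a\<close> fixed, \<open>v\<close> absorbs \<open>k\<close>, and
    \<open>a\<close> plays the part of the constant right factor.\<close>
  have W_xvy: "xyv ?W = xvy ?W"
    unfolding xyv_def xvy_def
  proof (rule bidual_lim_cong)
    fix a assume a: "a \<in> carrier A"
    let ?v = "bidual_embed A k \<otimes>\<^bsub>arens A\<^esub> v"
    have e: "L ?v (\<lambda>z. T b (z \<otimes> a)) = L v (\<lambda>c. ?W a b c)" if b: "b \<in> carrier A" for b
      using bidual_lim_embed_arens[OF k v form2_slot[OF form2_right[OF a T2] b]]
      by (simp add: mult_assoc a cong: bidual_lim_cong)
    have "L y (\<lambda>b. L v (\<lambda>c. ?W a b c)) = L y (\<lambda>b. L ?v (\<lambda>z. T b (z \<otimes> a)))"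
      by (intro bidual_lim_cong e[symmetric])
    also have "\<dots> = L ?v (\<lambda>z. L y (\<lambda>b. T b (z \<otimes> a)))"
      by (intro interchange_const T2 IT in_bd a k)
    also have "\<dots> = L v (\<lambda>c. L y (\<lambda>b. T b ((k \<otimes> c) \<otimes> a)))"
      by (intro bidual_lim_embed_arens k v form2_lim[OF y form2_flip[OF form2_right[OF a T2]]])
    also have "\<dots> = L v (\<lambda>c. L y (\<lambda>b. ?W a b c))"
      by (intro bidual_lim_cong) (simp add: mult_assoc a)
    finally show "L y (\<lambda>b. L v (\<lambda>c. ?W a b c)) = L v (\<lambda>c. L y (\<lambda>b. ?W a b c))" .
  qed
  \<comment> \<open>\<open>?J\<close> is the inner derivation of \<open>?g\<close>, evaluated at \<open>c\<close> and \<open>a \<otimes> b\<close>\<close>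
  have J_vxy: "vxy ?J = xvy ?J"
    using I[OF inner_derivation_form[OF g]] x y v unfolding interchange_def vxy_def xvy_def by blast
  \<comment> \<open>The exchange of the two outer limits passes from \<open>?P\<close> and
    \<open>?Q\<close> to \<open>?M\<close>, and through \<open>?J\<close> to \<open>?N\<close>; the
    exchange of the two inner limits reaches \<open>?N\<close> from \<open>?U\<close> and
    \<open>?W\<close>. Subtracting \<open>?R\<close>, for which both hold, settles
    \<open>?S\<close>.\<close>
  have M_vxy: "vxy ?M = xvy ?M"
    using P_vxy P_xvy Q_vxy diff(2,3)[OF M Q idP] by simp
  have N_vxy: "vxy ?N = xvy ?N"
    using J_vxy M_vxy diff(2,3)[OF M N refl] by simp
  have N_xvy: "xyv ?N = xvy ?N"
    using U_xvy W_xvy diff(1,2)[OF N W idU] by simp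
  have "xyv ?S = vxy ?S"
    using N_vxy N_xvy R_vxy R_xvy diff(1,3)[OF N R idS] by simp
  then show ?thesis by (simp only: xyv_def vxy_def)
qed

text \<open>The difference \<open>\<Phi> m p\<close> of the two orders is a bounded functional in
  each variable. It vanishes when both arguments are Arens products; \<open>arens_dense\<close>,
  applied first in \<open>p\<close> and then in \<open>m\<close>, extends this to all
  arguments.\<close>

lemma lim_commute:
  assumes wa: "weakly_amenable (arens A)"
    and T: "derivation_form A T" and I: "\<And>S. derivation_form A S \<Longrightarrow> interchange S"
    and m: "m \<in> bd" and p: "p \<in> bd"
  shows "L m (\<lambda>a. L p (T a)) = L p (\<lambda>b. L m (\<lambda>a. T a b))"
proof -
  interpret b: normed_space "bidual A" by (rule normed_space.dual_normed[OF dual_normed])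
  have T2: "form2 A T" using T by (simp add: derivation_form_def)
  note flip = form2_flip[OF T2]
  define \<Phi> where "\<Phi> m p = L m (\<lambda>a. L p (T a)) - L p (\<lambda>b. L m (\<lambda>a. T a b))" for m p
  have products: "\<Phi> (x \<otimes>\<^bsub>arens A\<^esub> y) (u \<otimes>\<^bsub>arens A\<^esub> v) = 0"
    if x: "x \<in> bd" and y: "y \<in> bd" and u: "u \<in> bd" and v: "v \<in> bd" for x y u v
  proof -
    let ?m = "x \<otimes>\<^bsub>arens A\<^esub> y"
    have m: "?m \<in> bd" using x y by (rule arens_closed)
    have Tv: "form2 A (\<lambda>a k. L v (\<lambda>c. T a (k \<otimes> c)))" by (rule form3_lim[OF v form3_mult_right[OF T2]])
    have "L ?m (\<lambda>a. L (u \<otimes>\<^bsub>arens A\<^esub> v) (T a)) = L ?m (\<lambda>a. L u (\<lambda>k. L v (\<lambda>c. T a (k \<otimes> c))))"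
      by (intro bidual_lim_cong bidual_lim_arens form2_slot[OF T2])
    \<comment> \<open>\<open>interchange\<close> brings \<open>u\<close> outermost; then
      \<open>k\<close> is fixed, and \<open>interchange_product\<close> can move \<open>v\<close>
      past \<open>x\<close> and \<open>y\<close>.\<close>
    also have "\<dots> = L u (\<lambda>k. L ?m (\<lambda>a. L v (\<lambda>c. T a (k \<otimes> c))))"
      using I[OF T] m u v unfolding interchange_def by blast
    also have "\<dots> = L u (\<lambda>k. L x (\<lambda>a. L y (\<lambda>b. L v (\<lambda>c. T (a \<otimes> b) (k \<otimes> c)))))"
      by (intro bidual_lim_cong bidual_lim_arens form2_slot2[OF Tv])
    also have "\<dots> = L u (\<lambda>k. L v (\<lambda>c. L x (\<lambda>a. L y (\<lambda>b. T (a \<otimes> b) (k \<otimes> c)))))"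
      by (intro bidual_lim_cong interchange_product T I x y v)
    also have "\<dots> = L u (\<lambda>k. L v (\<lambda>c. L ?m (\<lambda>a. T a (k \<otimes> c))))"
      by (intro bidual_lim_cong bidual_lim_arens[symmetric] form2_slot2[OF T2] mult_closed)
    also have "\<dots> = L (u \<otimes>\<^bsub>arens A\<^esub> v) (\<lambda>b. L ?m (\<lambda>a. T a b))"
      by (rule bidual_lim_arens[symmetric, OF form2_lim[OF m flip]])
    finally show ?thesis by (simp add: \<Phi>_def)
  qed
  have left: "\<Phi> (x \<otimes>\<^bsub>arens A\<^esub> y) p = 0" if x: "x \<in> bd" and y: "y \<in> bd" for x y
  proof (rule arens_dense[OF wa _ _ p])
    have m: "x \<otimes>\<^bsub>arens A\<^esub> y \<in> bd" using x y by (rule arens_closed)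
    show "form1 (bidual A) (\<Phi> (x \<otimes>\<^bsub>arens A\<^esub> y))"
      unfolding \<Phi>_def by (intro b.form1_diff form1_bidual_lim form1_bidual_lim_lim m T2 form2_lim[OF m flip])
  qed (rule products[OF x y])
  have "\<Phi> m p = 0"
  proof (rule arens_dense[OF wa _ _ m])
    show "form1 (bidual A) (\<lambda>m. \<Phi> m p)"
      unfolding \<Phi>_def
      by (intro b.form1_diff form1_bidual_lim form1_bidual_lim_lim[OF flip] p form2_lim[OF p T2])
  qed (rule left)
  then show ?thesis by (simp add: \<Phi>_def)
qed

text \<open>Limits of the cyclic identity in the order \<open>a, b, c\<close> give the left side and
  the first term at once. The remaining term \<open>T b (c \<otimes> a)\<close> is a limit along the
  product of \<open>p\<close> and \<open>m\<close> only in the order \<open>b, c, a\<close>; this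
  order is reached through \<open>a, c, b\<close> and \<open>b, a, c\<close>.\<close>

lemma biadjoint_derivation_rule:
  assumes T: "derivation_form A T"
    and comm: "\<And>m p. \<lbrakk>m \<in> bd; p \<in> bd\<rbrakk> \<Longrightarrow> L m (\<lambda>a. L p (T a)) = L p (\<lambda>b. L m (\<lambda>a. T a b))"
    and m: "m \<in> bd" and n: "n \<in> bd" and p: "p \<in> bd"
  shows "L (m \<otimes>\<^bsub>arens A\<^esub> n) (\<lambda>a. L p (T a)) =
    L m (\<lambda>a. L (n \<otimes>\<^bsub>arens A\<^esub> p) (T a)) + L n (\<lambda>b. L (p \<otimes>\<^bsub>arens A\<^esub> m) (T b))"
proof -
  have T2: "form2 A T" and der: "\<And>a b c. \<lbrakk>a \<in> carrier A; b \<in> carrier A; c \<in> carrier A\<rbrakk> \<Longrightarrow>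
      T (a \<otimes> b) c = T a (b \<otimes> c) + T b (c \<otimes> a)"
    using T by (auto simp: derivation_form_def)
  note flip = form2_flip[OF T2]
  note in_bd = bidual_embed_in_carrier arens_closed arens_second_closed m n p
  have first: "form3 A (\<lambda>a b c. T a (b \<otimes> c))" by (rule form3_mult_right[OF T2])
  have prod: "form3 A (\<lambda>a b c. T (a \<otimes> b) c)" by (rule form3_mult_left[OF T2])
  \<comment> \<open>\<open>T b\<close> is weakly almost periodic\<close>
  have wap: "L m (\<lambda>a. L p (\<lambda>c. T b (c \<otimes> a))) = L p (\<lambda>c. L m (\<lambda>a. T b (c \<otimes> a)))"
    if b: "b \<in> carrier A" for b
  proof -
    have f1: "form2 A (\<lambda>a c. T (a \<otimes> b) c)" by (rule form3_slot[OF form3_swap[OF prod] b])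
    have f2: "form2 A (\<lambda>a c. T a (b \<otimes> c))" by (rule form2_left[OF b T2])
    \<comment> \<open>The cyclic identity, solved for \<open>T b (c \<otimes> a)\<close>, leaves two
      forms to which \<open>comm\<close> applies once \<open>b\<close> is absorbed into
      \<open>m\<close> or into \<open>p\<close>.\<close>
    have id: "T b (c \<otimes> a) = T (a \<otimes> b) c - T a (b \<otimes> c)" if "a \<in> carrier A" "c \<in> carrier A" for a c
      using der[OF that(1) b that(2)] by simp
    have c1: "L m (\<lambda>a. L p (\<lambda>c. T (a \<otimes> b) c)) = L p (\<lambda>c. L m (\<lambda>a. T (a \<otimes> b) c))"
    proof -
      let ?m = "m \<otimes>\<^bsub>arens A\<^esub> bidual_embed A b"
      have "L m (\<lambda>a. L p (\<lambda>c. T (a \<otimes> b) c)) = L ?m (\<lambda>a. L p (T a))"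
        by (intro bidual_lim_arens_embed[symmetric] b form2_lim[OF p T2])
      also have "\<dots> = L p (\<lambda>c. L ?m (\<lambda>a. T a c))" by (intro comm in_bd b)
      also have "\<dots> = L p (\<lambda>c. L m (\<lambda>a. T (a \<otimes> b) c))"
        by (intro bidual_lim_cong bidual_lim_arens_embed b form2_slot2[OF T2])
      finally show ?thesis .
    qed
    have c2: "L m (\<lambda>a. L p (\<lambda>c. T a (b \<otimes> c))) = L p (\<lambda>c. L m (\<lambda>a. T a (b \<otimes> c)))"
    proof -
      let ?p = "bidual_embed A b \<otimes>\<^bsub>arens A\<^esub> p"
      have "L m (\<lambda>a. L p (\<lambda>c. T a (b \<otimes> c))) = L m (\<lambda>a. L ?p (T a))"
        by (intro bidual_lim_cong bidual_lim_embed_arens[symmetric] b p form2_slot[OF T2])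
      also have "\<dots> = L ?p (\<lambda>c. L m (\<lambda>a. T a c))" by (intro comm in_bd b)
      also have "\<dots> = L p (\<lambda>c. L m (\<lambda>a. T a (b \<otimes> c)))"
        by (intro bidual_lim_embed_arens b p form2_lim[OF m flip])
      finally show ?thesis .
    qed
    have "L m (\<lambda>a. L p (\<lambda>c. T b (c \<otimes> a))) =
        L m (\<lambda>a. L p (\<lambda>c. T (a \<otimes> b) c) - L p (\<lambda>c. T a (b \<otimes> c)))"
    proof (rule bidual_lim_cong)
      fix a assume a: "a \<in> carrier A"
      have "L p (\<lambda>c. T b (c \<otimes> a)) = L p (\<lambda>c. T (a \<otimes> b) c - T a (b \<otimes> c))"
        by (intro bidual_lim_cong id a)
      then show "L p (\<lambda>c. T b (c \<otimes> a)) = L p (\<lambda>c. T (a \<otimes> b) c) - L p (\<lambda>c. T a (b \<otimes> c))"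
        using bidual_lim_diff[OF p form2_slot[OF f1 a] form2_slot[OF f2 a]] by simp
    qed
    also have "\<dots> = L m (\<lambda>a. L p (\<lambda>c. T (a \<otimes> b) c)) - L m (\<lambda>a. L p (\<lambda>c. T a (b \<otimes> c)))"
      by (rule bidual_lim_diff[OF m form2_lim[OF p f1] form2_lim[OF p f2]])
    also have "\<dots> = L p (\<lambda>c. L m (\<lambda>a. T (a \<otimes> b) c)) - L p (\<lambda>c. L m (\<lambda>a. T a (b \<otimes> c)))"
      by (simp only: c1 c2)
    also have "\<dots> = L p (\<lambda>c. L m (\<lambda>a. T (a \<otimes> b) c) - L m (\<lambda>a. T a (b \<otimes> c)))"
      by (rule bidual_lim_diff[symmetric, OF p form2_lim[OF m form2_flip[OF f1]] form2_lim[OF m form2_flip[OF f2]]])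
    also have "\<dots> = L p (\<lambda>c. L m (\<lambda>a. T b (c \<otimes> a)))"
    proof (rule bidual_lim_cong)
      fix c assume c: "c \<in> carrier A"
      have "L m (\<lambda>a. T b (c \<otimes> a)) = L m (\<lambda>a. T (a \<otimes> b) c - T a (b \<otimes> c))"
        by (intro bidual_lim_cong id c)
      then show "L m (\<lambda>a. T (a \<otimes> b) c) - L m (\<lambda>a. T a (b \<otimes> c)) = L m (\<lambda>a. T b (c \<otimes> a))"
        using bidual_lim_diff[OF m form2_slot2[OF f1 c] form2_slot2[OF f2 c]] by simp
    qed
    finally show ?thesis .
  qed
  have "L (m \<otimes>\<^bsub>arens A\<^esub> n) (\<lambda>a. L p (T a)) = L m (\<lambda>a. L n (\<lambda>b. L p (\<lambda>c. T (a \<otimes> b) c)))"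
    by (intro bidual_lim_arens form2_lim[OF p T2])
  then have "L m (\<lambda>a. L n (\<lambda>b. L p (\<lambda>c. T b (c \<otimes> a)))) =
      L (m \<otimes>\<^bsub>arens A\<^esub> n) (\<lambda>a. L p (T a)) - L m (\<lambda>a. L n (\<lambda>b. L p (\<lambda>c. T a (b \<otimes> c))))"
    using iterated_lim_diff[OF prod first _ m n p, of "\<lambda>a b c. T b (c \<otimes> a)"] der by simp
  moreover have "L m (\<lambda>a. L n (\<lambda>b. L p (\<lambda>c. T a (b \<otimes> c)))) = L m (\<lambda>a. L (n \<otimes>\<^bsub>arens A\<^esub> p) (T a))"
    by (intro bidual_lim_cong bidual_lim_arens[symmetric] form2_slot[OF T2])
  moreover have "L m (\<lambda>a. L n (\<lambda>b. L p (\<lambda>c. T b (c \<otimes> a)))) = L n (\<lambda>b. L (p \<otimes>\<^bsub>arens A\<^esub> m) (T b))"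
  proof -
    have "L m (\<lambda>a. L n (\<lambda>b. L p (\<lambda>c. T b (c \<otimes> a)))) = L m (\<lambda>a. L p (\<lambda>c. L n (\<lambda>b. T b (c \<otimes> a))))"
    proof (rule bidual_lim_cong)
      fix a assume a: "a \<in> carrier A"
      let ?p = "p \<otimes>\<^bsub>arens A\<^esub> bidual_embed A a"
      have "L n (\<lambda>b. L p (\<lambda>c. T b (c \<otimes> a))) = L n (\<lambda>b. L ?p (T b))"
        by (intro bidual_lim_cong bidual_lim_arens_embed[symmetric] a form2_slot[OF T2])
      also have "\<dots> = L ?p (\<lambda>c. L n (\<lambda>b. T b c))" by (intro comm in_bd a)
      also have "\<dots> = L p (\<lambda>c. L n (\<lambda>b. T b (c \<otimes> a)))"
        by (intro bidual_lim_arens_embed a form2_lim[OF n flip])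
      finally show "L n (\<lambda>b. L p (\<lambda>c. T b (c \<otimes> a))) = L p (\<lambda>c. L n (\<lambda>b. T b (c \<otimes> a)))" .
    qed
    \<comment> \<open>Merging \<open>c\<close> and \<open>a\<close> with \<open>a\<close> outermost
      produces the second Arens product. Once \<open>b\<close> has been moved outside it, weak
      almost periodicity replaces it by the first.\<close>
    also have "\<dots> = L (arens_second A p m) (\<lambda>z. L n (\<lambda>b. T b z))"
      by (intro bidual_lim_arens_second[symmetric] form2_lim[OF n flip])
    also have "\<dots> = L n (\<lambda>b. L (arens_second A p m) (T b))"
      by (intro comm[symmetric] in_bd)
    also have "\<dots> = L n (\<lambda>b. L m (\<lambda>a. L p (\<lambda>c. T b (c \<otimes> a))))"
      by (intro bidual_lim_cong bidual_lim_arens_second form2_slot[OF T2])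
    also have "\<dots> = L n (\<lambda>b. L p (\<lambda>c. L m (\<lambda>a. T b (c \<otimes> a))))"
      by (intro bidual_lim_cong wap)
    also have "\<dots> = L n (\<lambda>b. L (p \<otimes>\<^bsub>arens A\<^esub> m) (T b))"
      by (intro bidual_lim_cong bidual_lim_arens[symmetric] form2_slot[OF T2])
    finally show ?thesis .
  qed
  ultimately show ?thesis by (simp add: algebra_simps)
qed

end

section \<open>Descent from the bidual to the algebra\<close>

theorem theorem2:
  fixes A :: "('k::{real_normed_field,banach}, 'a) normed_module"
  assumes "banach_algebra A"
    and "\<And>D. derivation A D \<Longrightarrow>
      linear_biadjoint A (dual A) D ` carrier (bidual A)
        \<subseteq> left_topological_centre (dual A) A (dual A) (bilinear_adjoint A (mult A))"
    and "weakly_amenable (arens A)"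
  shows "weakly_amenable A"
  unfolding weakly_amenable_def
proof (intro allI impI)
  interpret banach_algebra A by fact
  interpret b: normed_space "bidual A" by (rule normed_space.dual_normed[OF dual_normed])
  fix D assume D: "derivation A D"
  have T: "derivation_form A D" by (rule derivation_form_of_derivation[OF D])
  then have T2: "form2 A D" by (simp add: derivation_form_def)
  \<comment> \<open>Stated for all derivation forms and not only for \<open>D\<close>, because
    \<open>interchange_product\<close> also applies it to inner derivations.\<close>
  have I: "interchange S" if "derivation_form A S" for S
    unfolding interchange_def
    by (intro ballI centre_interchange that assms(2) derivation_of_derivation_form)
  have comm: "L m (\<lambda>a. L p (D a)) = L p (\<lambda>b. L m (\<lambda>a. D a b))" if "m \<in> bd" "p \<in> bd" for m p
    by (rule lim_commute[OF assms(3) T I that])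
  \<comment> \<open>\<open>E\<close> is the second adjoint of \<open>D\<close>, written as an
    iterated limit. Once it is a derivation of the bidual, weak amenability makes it inner.\<close>
  define E where "E m = (\<lambda>p\<in>bd. L m (\<lambda>a. L p (D a)))" for m
  obtain C where C: "C \<ge> 0"
    "\<And>m x. \<lbrakk>m \<in> bd; x \<in> carrier A\<rbrakk> \<Longrightarrow> norm (L m (D x)) \<le> (nrm (bidual A) m * C) * nrm A x"
    using form2_lim_bound[OF T2] by blast
  have E_bound: "nrm (dual (bidual A)) (E m) \<le> C * nrm (bidual A) m" if m: "m \<in> bd" for m
    unfolding E_def
  proof (rule b.nrm_dual_le)
    show "0 \<le> C * nrm (bidual A) m" using C(1) b.nrm_nonneg[OF m] by simp
    fix p assume p: "p \<in> bd"
    have "norm (L m (\<lambda>a. L p (D a))) \<le> nrm (bidual A) m * (nrm (bidual A) p * C)"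
      using C b.nrm_nonneg[OF p] p by (intro norm_bidual_lim_le[OF m form2_lim[OF p T2]]) auto
    then show "norm (L m (\<lambda>a. L p (D a))) \<le> C * nrm (bidual A) m * nrm (bidual A) p"
      by (simp add: mult_ac)
  qed
  have "bounded_linear_map (arens A) (dual (arens A)) E"
    unfolding bounded_linear_map_def arens_simps
  proof (intro conjI ballI allI)
    show "E \<in> bd \<rightarrow> carrier (dual (bidual A))"
      by (auto simp: E_def b.restrict_in_dual_iff intro!: form1_bidual_lim_lim T2)
    show "\<exists>C. \<forall>m\<in>bd. nrm (dual (bidual A)) (E m) \<le> C * nrm (bidual A) m" using E_bound by blast
    fix m assume m: "m \<in> bd"
    show "E (c \<odot>\<^bsub>bidual A\<^esub> m) = c \<odot>\<^bsub>dual (bidual A)\<^esub> E m" for c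
      unfolding E_def dual_simps(2)[where X = "bidual A"]
      by (rule restrict_ext) (simp add: bidual_lim_bidual_smult m form2_lim[OF _ T2])
    fix n assume n: "n \<in> bd"
    show "E (m \<oplus>\<^bsub>bidual A\<^esub> n) = E m \<oplus>\<^bsub>dual (bidual A)\<^esub> E n"
      unfolding E_def dual_simps(1)[where X = "bidual A"]
      by (rule restrict_ext) (simp add: bidual_lim_bidual_add m n form2_lim[OF _ T2])
  qed
  moreover have "E (m \<otimes>\<^bsub>arens A\<^esub> n) =
      dual_right_act (arens A) (E m) n \<oplus>\<^bsub>dual (arens A)\<^esub> dual_left_act (arens A) m (E n)"
    if "m \<in> bd" "n \<in> bd" for m n
    unfolding E_def dual_right_act_def dual_left_act_def arens_simps dual_simps(1)[where X = "bidual A"]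
    by (rule restrict_ext) (simp add: biadjoint_derivation_rule[OF T comm that] that arens_closed)
  ultimately have "derivation (arens A) E" by (simp add: derivation_def arens_simps)
  then obtain \<Psi> where \<Psi>: "form1 (bidual A) \<Psi>"
    "\<And>m n. \<lbrakk>m \<in> bd; n \<in> bd\<rbrakk> \<Longrightarrow> E m n = \<Psi> (n \<otimes>\<^bsub>arens A\<^esub> m) - \<Psi> (m \<otimes>\<^bsub>arens A\<^esub> n)"
    using weakly_amenable_arens_inner[OF assms(3)] by blast
  let ?i = "bidual_embed A"
  \<comment> \<open>Limits along embedded points are evaluations, so the Arens product extends the
    product of the algebra.\<close>
  have embed_mult: "?i a \<otimes>\<^bsub>arens A\<^esub> ?i b = ?i (a \<otimes>\<^bsub>A\<^esub> b)" if a: "a \<in> carrier A" and b: "b \<in> carrier A" for a b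
    by (rule bidual_eqI)
      (simp_all add: a b mult_closed bidual_embed_in_carrier arens_closed bidual_lim_arens_embed
        bidual_lim_embed form2_slot2[OF form2_mult])
  \<comment> \<open>The functional implementing \<open>E\<close>, restricted to the copy of the
    algebra in its bidual, is the candidate for implementing \<open>D\<close>.\<close>
  define g where "g = (\<lambda>a\<in>carrier A. \<Psi> (?i a))"
  have g: "g \<in> carrier (dual A)"
  proof -
    obtain K where K: "K \<ge> 0" "\<And>m. m \<in> bd \<Longrightarrow> norm (\<Psi> m) \<le> K * nrm (bidual A) m"
      using \<Psi>(1) by (auto simp: form1_def)
    have "?i (a \<oplus>\<^bsub>A\<^esub> b) = ?i a \<oplus>\<^bsub>bidual A\<^esub> ?i b" if "a \<in> carrier A" "b \<in> carrier A" for a b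
      unfolding bidual_embed_def dual_simps(1)[where X = "dual A"]
      by (rule restrict_ext) (simp add: that form1D[OF form1_dual])
    moreover have "?i (c \<odot>\<^bsub>A\<^esub> a) = c \<odot>\<^bsub>bidual A\<^esub> ?i a" if "a \<in> carrier A" for a c
      unfolding bidual_embed_def dual_simps(2)[where X = "dual A"]
      by (rule restrict_ext) (simp add: that form1D[OF form1_dual])
    moreover have "norm (\<Psi> (?i a)) \<le> K * nrm A a" if a: "a \<in> carrier A" for a
    proof -
      \<comment> \<open>The canonical embedding does not increase norms, so \<open>g\<close>
        inherits the bound of \<open>\<Psi>\<close>.\<close>
      have "nrm (bidual A) (?i a) \<le> nrm A a"
        unfolding bidual_embed_def
        by (rule normed_space.nrm_dual_le[OF dual_normed nrm_nonneg[OF a]])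
          (use norm_dual_le[OF _ a] in \<open>simp add: mult.commute\<close>)
      then have "K * nrm (bidual A) (?i a) \<le> K * nrm A a" by (rule mult_left_mono[OF _ K(1)])
      then show ?thesis using K(2)[OF bidual_embed_in_carrier[OF a]] by simp
    qed
    ultimately show ?thesis
      unfolding g_def restrict_in_dual_iff form1_def linear_form_def
      using K(1) b.form1D[OF \<Psi>(1)] bidual_embed_in_carrier by auto
  qed
  have Dg: "D a b = g (b \<otimes>\<^bsub>A\<^esub> a) - g (a \<otimes>\<^bsub>A\<^esub> b)" if a: "a \<in> carrier A" and b: "b \<in> carrier A" for a b
  proof -
    have "D a b = L (?i a) (\<lambda>x. L (?i b) (D x))"
      using bidual_lim_embed[OF a form2_lim[OF bidual_embed_in_carrier[OF b] T2]]
        bidual_lim_embed[OF b form2_slot[OF T2 a]] by simp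
    also have "\<dots> = E (?i a) (?i b)" by (simp add: E_def bidual_embed_in_carrier b)
    also have "\<dots> = \<Psi> (?i b \<otimes>\<^bsub>arens A\<^esub> ?i a) - \<Psi> (?i a \<otimes>\<^bsub>arens A\<^esub> ?i b)"
      by (intro \<Psi>(2) bidual_embed_in_carrier a b)
    also have "\<dots> = g (b \<otimes>\<^bsub>A\<^esub> a) - g (a \<otimes>\<^bsub>A\<^esub> b)" by (simp add: embed_mult a b g_def mult_closed)
    finally show ?thesis .
  qed
  show "inner_derivation A D"
    unfolding inner_derivation_def
  proof (intro bexI[OF _ g] ballI)
    fix a assume a: "a \<in> carrier A"
    have m2: "form2 A (\<lambda>x y. g (x \<otimes>\<^bsub>A\<^esub> y))" by (rule form2_mult[OF form1_dual[OF g]])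
    have acts: "dual_left_act A a g \<in> carrier (dual A)" "dual_right_act A g a \<in> carrier (dual A)"
      unfolding dual_left_act_def dual_right_act_def restrict_in_dual_iff
      by (rule form2_slot2[OF m2 a], rule form2_slot[OF m2 a])
    have "D a \<in> carrier (dual A)"
      using D a by (auto simp: derivation_def bounded_linear_map_def)
    then have "D a = (\<lambda>b\<in>carrier A. D a b)" by (simp add: restrict_dual)
    also have "\<dots> = dual_left_act A a g \<ominus>\<^bsub>dual A\<^esub> dual_right_act A g a"
      unfolding dual_minus_apply[OF acts]
      by (rule restrict_ext) (simp add: Dg a dual_left_act_def dual_right_act_def)
    finally show "D a = dual_left_act A a g \<ominus>\<^bsub>dual A\<^esub> dual_right_act A g a" .
  qed
qed

end
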